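(* Given $\vec a=(a_1\ge a_2\ge\dots\ge a_N\ge 0)$, take $N$ to be fixed and let $M\to\infty$, $\theta\to0$, $M\theta\to\infty$. Then $$B\bigl(\vec a,\,M\theta\,x_1,\dots,M\theta\,x_N;\theta,N,M\bigr)\longrightarrow\frac1{N!}\sum_{\sigma\in S_N}\prod_{i=1}^Ne^{a_i^2x_{\sigma(i)}^2},$$ where $S_N$ is the symmetric group of degree $N$.
   Context: Partitions $\mu=(\mu_1\ge\dots\ge\mu_N\ge0)$ of length at most $N$ are identified with Young diagrams with boxes $(i,j)$ (row $i$, column $j$); $\mu'_j$ is the length of column $j$, $|\mu|=\sum_i\mu_i$. For $\theta>0$, $P_\mu(y_1,\dots,y_N;\theta)$ is the Jack symmetric polynomial with parameter $\theta$ (Jack parameter $\alpha=1/\theta$), normalized so that the coefficient of the monomial symmetric polynomial $m_\mu$ is $1$. Let $H(\mu)=\prod_{(i,j)\in\mu}[\mu_i-j+1+\theta(\mu'_j-i)]$. For integers $M\ge N$ the type BC Bessel function is $$B(\vec a,x_1,\dots,x_N;\theta,N,M)=\sum_{\mu}\prod_{i=1}^N\frac{\Gamma(\theta M-\theta(i-1))}{\Gamma(\theta M-\theta(i-1)+\mu_i)}\cdot\frac{2^{-2|\mu|}}{H(\mu)}\cdot\frac{P_\mu(a_1^2,\dots,a_N^2;\theta)P_\mu(x_1^2,\dots,x_N^2;\theta)}{P_\mu(1^N;\theta)},$$ summed over all partitions of length at most $N$.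
   Formalization: The arguments Mθ·x_i of B are replaced by 2√(Mθ)·x_i, because with the printed scaling B diverges (for N=1, a=x=1 the k=1 term of the series is Mθ/4 → ∞); the stated limit is then correct. *)

theory Defs
  imports "HOL-Analysis.Analysis" "HOL-Combinatorics.Permutations"
begin

text \<open>
  A vector of length \<open>N\<close> is a function on \<open>nat\<close> of which only the values at \<open>1, \<dots>, N\<close> matter.
  Partitions are extended by \<open>0\<close> outside \<open>{1..N}\<close>, so that each one is a single function.
\<close>

definition Par :: "nat \<Rightarrow> (nat \<Rightarrow> nat) set" where
  "Par N = {\<mu>. (\<forall>i\<in>{1..N}. \<forall>j\<in>{1..N}. i \<le> j \<longrightarrow> \<mu> j \<le> \<mu> i) \<and> (\<forall>i. i \<notin> {1..N} \<longrightarrow> \<mu> i = 0)}"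

definition psize :: "nat \<Rightarrow> (nat \<Rightarrow> nat) \<Rightarrow> nat" where
  "psize N \<mu> = (\<Sum>i=1..N. \<mu> i)"

text \<open>Column lengths; only meaningful for \<open>j \<ge> 1\<close>.\<close>

definition conj_part :: "(nat \<Rightarrow> nat) \<Rightarrow> nat \<Rightarrow> nat" where
  "conj_part \<mu> j = card {i. j \<le> \<mu> i}"

definition dominates :: "nat \<Rightarrow> (nat \<Rightarrow> nat) \<Rightarrow> (nat \<Rightarrow> nat) \<Rightarrow> bool" where
  "dominates N \<mu> \<nu> \<longleftrightarrow>
     psize N \<nu> = psize N \<mu> \<and> (\<forall>k\<in>{1..N}. (\<Sum>i=1..k. \<nu> i) \<le> (\<Sum>i=1..k. \<mu> i))"

text \<open>The sum runs over the distinct rearrangements of \<open>\<nu>\<close>, so every monomial has coefficient 1.\<close>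

definition monom_sym :: "nat \<Rightarrow> (nat \<Rightarrow> nat) \<Rightarrow> (nat \<Rightarrow> complex) \<Rightarrow> complex" where
  "monom_sym N \<nu> y = (\<Sum>\<beta> \<in> {\<nu> \<circ> \<sigma> | \<sigma>. \<sigma> permutes {1..N}}. \<Prod>i=1..N. y i ^ \<beta> i)"

text \<open>
  The Laplace--Beltrami (Calogero--Sutherland) operator
  \<open>\<Sum>\<^sub>i y\<^sub>i\<^sup>2 \<partial>\<^sub>i\<^sup>2 + 2 \<theta> \<Sum>\<^sub>i \<Sum>\<^sub>j\<^sub>\<noteq>\<^sub>i y\<^sub>i\<^sup>2 / (y\<^sub>i - y\<^sub>j) \<partial>\<^sub>i\<close>,
  to be evaluated at points with pairwise distinct coordinates.
\<close>

definition partial :: "nat \<Rightarrow> ((nat \<Rightarrow> complex) \<Rightarrow> complex) \<Rightarrow> (nat \<Rightarrow> complex) \<Rightarrow> complex" where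
  "partial i f y = deriv (\<lambda>t. f (y(i := t))) (y i)"

definition laplace_beltrami ::
    "nat \<Rightarrow> real \<Rightarrow> ((nat \<Rightarrow> complex) \<Rightarrow> complex) \<Rightarrow> (nat \<Rightarrow> complex) \<Rightarrow> complex" where
  "laplace_beltrami N \<theta> f y =
     (\<Sum>i=1..N. (y i)\<^sup>2 * partial i (partial i f) y) +
     2 * of_real \<theta> * (\<Sum>i=1..N. \<Sum>j\<in>{1..N} - {i}. (y i)\<^sup>2 / (y i - y j) * partial i f y)"

text \<open>
  For \<open>\<theta> > 0\<close> and \<open>\<mu> \<in> Par N\<close>, the Jack polynomial \<open>P\<^sub>\<mu>(y\<^sub>1, \<dots>, y\<^sub>N; \<theta>)\<close> (Jack parameter
  \<open>\<alpha> = 1 / \<theta>\<close>) is the unique eigenfunction of this operator of the form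
  \<open>m\<^sub>\<mu> + \<Sum>\<^sub>\<nu> u\<^sub>\<nu> m\<^sub>\<nu>\<close> with \<open>\<nu>\<close> strictly below \<open>\<mu>\<close> in the dominance order.
\<close>

definition is_jack ::
    "nat \<Rightarrow> real \<Rightarrow> (nat \<Rightarrow> nat) \<Rightarrow> ((nat \<Rightarrow> complex) \<Rightarrow> complex) \<Rightarrow> bool" where
  "is_jack N \<theta> \<mu> P \<longleftrightarrow>
     (\<exists>u. u \<mu> = 1 \<and> P = (\<lambda>y. \<Sum>\<nu> \<in> {\<nu> \<in> Par N. dominates N \<mu> \<nu>}. u \<nu> * monom_sym N \<nu> y)) \<and>
     (\<exists>c. \<forall>y. inj_on y {1..N} \<longrightarrow> laplace_beltrami N \<theta> P y = c * P y)"

definition jack :: "nat \<Rightarrow> real \<Rightarrow> (nat \<Rightarrow> nat) \<Rightarrow> (nat \<Rightarrow> complex) \<Rightarrow> complex" where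
  "jack N \<theta> \<mu> = (THE P. is_jack N \<theta> \<mu> P)"

definition hook :: "nat \<Rightarrow> real \<Rightarrow> (nat \<Rightarrow> nat) \<Rightarrow> real" where
  "hook N \<theta> \<mu> =
     (\<Prod>i=1..N. \<Prod>j=1..\<mu> i. real (\<mu> i) - real j + 1 + \<theta> * (real (conj_part \<mu> j) - real i))"

definition bessel_BC ::
    "(nat \<Rightarrow> real) \<Rightarrow> (nat \<Rightarrow> complex) \<Rightarrow> real \<Rightarrow> nat \<Rightarrow> nat \<Rightarrow> complex" where
  "bessel_BC a x \<theta> N M =
     (\<Sum>\<^sub>\<infinity>\<mu>\<in>Par N.
        of_real ((\<Prod>i=1..N. Gamma (\<theta> * real M - \<theta> * (real i - 1)) /
                          Gamma (\<theta> * real M - \<theta> * (real i - 1) + real (\<mu> i))) *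
                 ((1 / 2 ^ (2 * psize N \<mu>)) / hook N \<theta> \<mu>)) *
        (jack N \<theta> \<mu> (\<lambda>i. of_real ((a i)\<^sup>2)) * jack N \<theta> \<mu> (\<lambda>i. (x i)\<^sup>2) /
         jack N \<theta> \<mu> (\<lambda>i. 1)))"

end

theory Submission
  imports Defs
begin

text \<open>
  On coefficients of symmetric polynomials the Laplace--Beltrami operator acts triangularly with
  nonnegative entries: it maps \<open>f\<close> to
  \<open>\<gamma> \<mapsto> lbeig \<gamma> * f \<gamma> + \<theta> * (\<Sum>\<^sub>i\<^sub>\<noteq>\<^sub>j \<Sum>\<^sub>m (\<gamma>\<^sub>i + \<gamma>\<^sub>j - 2 m) * f \<gamma>')\<close>, where \<open>m < min \<gamma>\<^sub>i \<gamma>\<^sub>j\<close> and \<open>\<gamma>'\<close> is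
  \<open>\<gamma>\<close> with \<open>(\<gamma>\<^sub>i, \<gamma>\<^sub>j)\<close> replaced by \<open>(\<gamma>\<^sub>i + \<gamma>\<^sub>j - m, m)\<close>. Since \<open>\<gamma>'\<close> has a larger sum of squares, the
  eigenvalue equation is a recursion that determines the Jack coefficients; they are nonnegative, and
  those off the orbit of \<open>\<mu>\<close> carry a factor \<open>\<theta>\<close>, so \<open>P\<^sub>\<mu>\<close> tends to \<open>m\<^sub>\<mu>\<close>. For \<open>\<theta> \<le> 1\<close> an explicit supersolution
  bounds all coefficients by a polynomial in \<open>|\<mu>|\<close>; with \<open>P\<^sub>\<mu>(1) \<ge> 1\<close> and \<open>H(\<mu>) \<ge> \<Prod>\<^sub>i \<mu>\<^sub>i!\<close> this dominates the
  series. The limit series is the exponential series of the right-hand side, grouped by orbits.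
\<close>

subsection \<open>Compositions and dominance\<close>

text \<open>Two demands shape the proof. \<open>jack\<close> is a definite description, so existence
  and uniqueness must be settled before anything can be said about it; and exchanging limit and sum
  needs a majorant that is uniform in \<open>\<theta>\<close>. One recursion serves both. Its
  denominators are eigenvalue differences, and for every \<open>\<theta> > 0\<close> they are at
  least the positive integer \<open>sumsq N \<mu> - sumsq N \<gamma>\<close>, because dominance
  makes the \<open>\<theta>\<close>-part of the difference nonnegative. Iterating the recursion
  naively would compound the sum over all pairs at every step; the polynomial bound arises because
  this same gap in \<open>sumsq\<close> pays for the telescoped sum. Coefficients are indexed by all
  exponent vectors, not only by partitions: the recursion then has no orbit multiplicities and needs
  no sorting, at the price of a dominance test that ignores the order of the parts. Polynomial
  growth in \<open>|\<mu>|\<close> is harmless, since the factorials from the hook product outweigh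
  it and every geometric factor.\<close>

definition Comp :: "nat \<Rightarrow> nat \<Rightarrow> (nat \<Rightarrow> nat) set" where
  "Comp N n = {\<beta>. (\<forall>i. i \<notin> {1..N} \<longrightarrow> \<beta> i = 0) \<and> psize N \<beta> = n}"

definition rearr :: "nat \<Rightarrow> (nat \<Rightarrow> nat) \<Rightarrow> (nat \<Rightarrow> nat) set" where
  "rearr N \<nu> = {\<nu> \<circ> \<sigma> | \<sigma>. \<sigma> permutes {1..N}}"

text \<open>Dominance by a partition, expressed for compositions without sorting them.\<close>

definition sub_dom :: "nat \<Rightarrow> (nat \<Rightarrow> nat) \<Rightarrow> (nat \<Rightarrow> nat) \<Rightarrow> bool" where
  "sub_dom N \<mu> \<beta> \<longleftrightarrow> psize N \<beta> = psize N \<mu> \<and> (\<forall>S\<subseteq>{1..N}. sum \<beta> S \<le> sum \<mu> {1..card S})"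

definition sumsq :: "nat \<Rightarrow> (nat \<Rightarrow> nat) \<Rightarrow> nat" where
  "sumsq N \<beta> = (\<Sum>i=1..N. (\<beta> i)\<^sup>2)"

text \<open>The diagonal contribution of the first-order part: for each ordered pair, the operator
  multiplies the coefficient of a monomial by the larger of its two exponents.\<close>

definition summax :: "nat \<Rightarrow> (nat \<Rightarrow> nat) \<Rightarrow> nat" where
  "summax N \<beta> = (\<Sum>i=1..N. \<Sum>j\<in>{1..N} - {i}. max (\<beta> i) (\<beta> j))"

text \<open>A power of the raising operator that moves units from position \<open>j\<close> to
  position \<open>i\<close>. For \<open>m < min (\<gamma> i) (\<gamma> j)\<close> the subtraction is
  exact and the new entry at \<open>i\<close> exceeds both old ones.\<close>

definition spread :: "(nat \<Rightarrow> nat) \<Rightarrow> nat \<Rightarrow> nat \<Rightarrow> nat \<Rightarrow> nat \<Rightarrow> nat" where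
  "spread \<gamma> i j m = \<gamma>(i := \<gamma> i + \<gamma> j - m, j := m)"

lemma finite_Comp [simp]: "finite (Comp N n)"
proof (rule finite_subset)
  show "Comp N n \<subseteq> {\<beta>. \<beta> \<in> {1..N} \<rightarrow> {..n} \<and> (\<forall>i. i \<notin> {1..N} \<longrightarrow> \<beta> i = 0)}"
  proof
    fix \<beta> assume b: "\<beta> \<in> Comp N n"
    have "\<beta> i \<le> n" if "i \<in> {1..N}" for i
      using b that member_le_sum[of i "{1..N}" \<beta>] by (auto simp: Comp_def psize_def)
    then show "\<beta> \<in> {\<beta>. \<beta> \<in> {1..N} \<rightarrow> {..n} \<and> (\<forall>i. i \<notin> {1..N} \<longrightarrow> \<beta> i = 0)}"
      using b by (auto simp: Comp_def)
  qed
  show "finite {\<beta>. \<beta> \<in> {1..N} \<rightarrow> {..n} \<and> (\<forall>i. i \<notin> {1..N} \<longrightarrow> \<beta> i = 0)}"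
    using finite_set_of_finite_funs[of "{1..N}" "{..n}" 0]
    by (rule rev_finite_subset) auto
qed

lemma Comp_le: "\<beta> \<in> Comp N n \<Longrightarrow> \<beta> i \<le> n"
  using member_le_sum[of i "{1..N}" \<beta>] by (cases "i \<in> {1..N}") (auto simp: Comp_def psize_def)

lemma sum_permutes_comp:
  assumes "\<sigma> permutes A"
  shows "(\<Sum>i\<in>A. g (\<beta> (\<sigma> i))) = (\<Sum>i\<in>A. g (\<beta> i))"
  using sum.permute[OF assms, of "\<lambda>i. g (\<beta> i)"] by (simp add: o_def)

lemma psize_permutes: "\<sigma> permutes {1..N} \<Longrightarrow> psize N (\<beta> \<circ> \<sigma>) = psize N \<beta>"
  unfolding psize_def o_def by (rule sum_permutes_comp)

lemma sumsq_permutes: "\<sigma> permutes {1..N} \<Longrightarrow> sumsq N (\<beta> \<circ> \<sigma>) = sumsq N \<beta>"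
  unfolding sumsq_def o_def using sum_permutes_comp[of \<sigma> _ "\<lambda>k. k\<^sup>2"] by blast

lemma sum_pairs_permutes:
  assumes \<sigma>: "\<sigma> permutes {1..N}"
  shows "(\<Sum>i=1..N. \<Sum>j\<in>{1..N} - {i}. g (\<sigma> i) (\<sigma> j)) = (\<Sum>i=1..N. \<Sum>j\<in>{1..N} - {i}. g i j)"
proof -
  have "(\<Sum>j\<in>{1..N} - {i}. g (\<sigma> i) (\<sigma> j)) = (\<Sum>j\<in>{1..N} - {\<sigma> i}. g (\<sigma> i) j)"
    if "i \<in> {1..N}" for i
  proof (rule sum.reindex_bij_betw)
    have "\<sigma> ` ({1..N} - {i}) = {1..N} - {\<sigma> i}"
      using permutes_image[OF \<sigma>] permutes_inj[OF \<sigma>] by (auto simp: inj_def image_iff)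
    then show "bij_betw \<sigma> ({1..N} - {i}) ({1..N} - {\<sigma> i})"
      using inj_on_subset[OF permutes_inj[OF \<sigma>]] by (auto simp: bij_betw_def)
  qed
  then have "(\<Sum>i=1..N. \<Sum>j\<in>{1..N} - {i}. g (\<sigma> i) (\<sigma> j))
      = (\<Sum>i=1..N. \<Sum>j\<in>{1..N} - {\<sigma> i}. g (\<sigma> i) j)"
    by simp
  also have "\<dots> = (\<Sum>i=1..N. \<Sum>j\<in>{1..N} - {i}. g i j)"
    by (rule sum.reindex_bij_betw[OF permutes_imp_bij[OF \<sigma>]])
  finally show ?thesis .
qed

lemma summax_permutes: "\<sigma> permutes {1..N} \<Longrightarrow> summax N (\<beta> \<circ> \<sigma>) = summax N \<beta>"
  unfolding summax_def o_def using sum_pairs_permutes[of \<sigma> N "\<lambda>i j. max (\<beta> i) (\<beta> j)"] by simp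

lemma Comp_permutes: "\<sigma> permutes {1..N} \<Longrightarrow> \<beta> \<in> Comp N n \<Longrightarrow> \<beta> \<circ> \<sigma> \<in> Comp N n"
  by (auto simp: Comp_def psize_permutes[unfolded o_def] o_def dest: permutes_not_in)

lemma Par_subset_Comp: "\<mu> \<in> Par N \<Longrightarrow> \<mu> \<in> Comp N (psize N \<mu>)"
  by (auto simp: Par_def Comp_def)

lemma rearr_refl [simp]: "\<mu> \<in> rearr N \<mu>"
  unfolding rearr_def by (metis (mono_tags, lifting) comp_id mem_Collect_eq permutes_id)

lemma finite_rearr [simp]: "finite (rearr N \<mu>)"
proof -
  have "rearr N \<mu> = (\<lambda>\<sigma>. \<mu> \<circ> \<sigma>) ` {\<sigma>. \<sigma> permutes {1..N}}"
    by (auto simp: rearr_def)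
  then show ?thesis by (simp add: finite_permutations)
qed

lemma rearr_permutes: "\<sigma> permutes {1..N} \<Longrightarrow> \<gamma> \<in> rearr N \<mu> \<Longrightarrow> \<gamma> \<circ> \<sigma> \<in> rearr N \<mu>"
  unfolding rearr_def using permutes_compose by (force simp: o_assoc[symmetric])

lemma rearr_sym:
  assumes "\<gamma> \<in> rearr N \<mu>" shows "\<mu> \<in> rearr N \<gamma>"
proof -
  obtain \<sigma> where \<sigma>: "\<gamma> = \<mu> \<circ> \<sigma>" "\<sigma> permutes {1..N}" using assms by (auto simp: rearr_def)
  then have "\<mu> = \<gamma> \<circ> inv \<sigma>"
    by (simp add: o_assoc[symmetric] permutes_inv_o)
  then show ?thesis using permutes_inv[OF \<sigma>(2)] by (auto simp: rearr_def)
qed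

lemma rearr_trans: "\<gamma> \<in> rearr N \<mu> \<Longrightarrow> \<mu> \<in> rearr N \<nu> \<Longrightarrow> \<gamma> \<in> rearr N \<nu>"
  using rearr_permutes unfolding rearr_def[of N \<mu>] by blast

lemma rearr_permutes_iff:
  assumes \<sigma>: "\<sigma> permutes {1..N}" shows "\<gamma> \<circ> \<sigma> \<in> rearr N \<mu> \<longleftrightarrow> \<gamma> \<in> rearr N \<mu>"
proof -
  have "\<gamma> \<circ> \<sigma> \<in> rearr N \<gamma>" using \<sigma> by (auto simp: rearr_def)
  then show ?thesis using rearr_trans rearr_sym by blast
qed

lemma rearr_Comp: "\<gamma> \<in> rearr N \<mu> \<Longrightarrow> \<mu> \<in> Comp N n \<Longrightarrow> \<gamma> \<in> Comp N n"
  by (auto simp: rearr_def Comp_permutes)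

section \<open>Dominance tested on arbitrary index sets\<close>

lemma sub_dom_permutes:
  assumes \<sigma>: "\<sigma> permutes {1..N}" and d: "sub_dom N \<mu> \<beta>"
  shows "sub_dom N \<mu> (\<beta> \<circ> \<sigma>)"
  unfolding sub_dom_def
proof (intro conjI allI impI)
  show "psize N (\<beta> \<circ> \<sigma>) = psize N \<mu>" using d by (simp add: psize_permutes[OF \<sigma>] sub_dom_def)
  fix S assume S: "S \<subseteq> {1..N}"
  have i: "inj_on \<sigma> S" using permutes_inj[OF \<sigma>] by (rule inj_on_subset) simp
  have "sum (\<beta> \<circ> \<sigma>) S = sum \<beta> (\<sigma> ` S)" by (simp add: sum.reindex[OF i])
  also have "\<dots> \<le> sum \<mu> {1..card (\<sigma> ` S)}"
  proof -
    have "\<sigma> ` S \<subseteq> {1..N}" using image_mono[OF S, of \<sigma>] by (simp only: permutes_image[OF \<sigma>])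
    then show ?thesis using d by (simp add: sub_dom_def)
  qed
  finally show "sum (\<beta> \<circ> \<sigma>) S \<le> sum \<mu> {1..card S}" using card_image[OF i] by simp
qed

lemma sub_dom_permutes_iff:
  assumes \<sigma>: "\<sigma> permutes {1..N}" shows "sub_dom N \<mu> (\<beta> \<circ> \<sigma>) \<longleftrightarrow> sub_dom N \<mu> \<beta>"
proof
  assume "sub_dom N \<mu> (\<beta> \<circ> \<sigma>)"
  from sub_dom_permutes[OF permutes_inv[OF \<sigma>] this] show "sub_dom N \<mu> \<beta>"
    by (simp add: o_assoc[symmetric] permutes_inv_o[OF \<sigma>])
qed (rule sub_dom_permutes[OF \<sigma>])

text \<open>With \<open>k = card S\<close>, the sets \<open>S - {1..k}\<close> and
  \<open>{1..k} - S\<close> have equally many elements, and \<open>\<mu> k\<close> separates the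
  values of \<open>\<mu>\<close> on them.\<close>

lemma Par_sum_le:
  assumes \<mu>: "\<mu> \<in> Par N" and S: "S \<subseteq> {1..N}"
  shows "sum \<mu> S \<le> sum \<mu> {1..card S}"
proof (cases "S = {}")
  case False
  define k where "k = card S"
  have fS: "finite S" using S finite_subset by blast
  have k: "1 \<le> k" "k \<le> N"
    using False fS card_mono[OF _ S] by (auto simp: k_def card_gt_0_iff Suc_le_eq)
  have c: "card (S - {1..k}) = card ({1..k} - S)"
    using card_Int_Diff[of S "{1..k}"] card_Int_Diff[of "{1..k}" S] fS
    by (simp add: k_def Int_commute)
  have "sum \<mu> (S - {1..k}) \<le> card (S - {1..k}) * \<mu> k"
  proof -
    have "\<mu> i \<le> \<mu> k" if "i \<in> S - {1..k}" for i
    proof -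
      have "i \<in> {1..N}" "k \<le> i" using that S by auto
      then show ?thesis using \<mu> k by (auto simp: Par_def)
    qed
    then show ?thesis using sum_bounded_above[of "S - {1..k}" \<mu> "\<mu> k"] by simp
  qed
  also have "\<dots> = card ({1..k} - S) * \<mu> k" by (simp only: c)
  also have "\<dots> \<le> sum \<mu> ({1..k} - S)"
    using sum_bounded_below[of "{1..k} - S" "\<mu> k" \<mu>] \<mu> k by (auto simp: Par_def)
  finally have *: "sum \<mu> (S - {1..k}) \<le> sum \<mu> ({1..k} - S)" .
  have "sum \<mu> S = sum \<mu> (S - {1..k}) + sum \<mu> (S \<inter> {1..k})"
    using sum.Int_Diff[OF fS, of \<mu> "{1..k}"] by simp
  also have "\<dots> \<le> sum \<mu> ({1..k} - S) + sum \<mu> (S \<inter> {1..k})" using * by simp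
  also have "\<dots> = sum \<mu> {1..k}"
    using sum.Int_Diff[of "{1..k}" \<mu> S] by (simp add: Int_commute)
  finally show ?thesis by (simp add: k_def)
qed simp

text \<open>Among the index sets of a given size, the initial segment has the largest sum of parts
  of a partition, so testing it tests them all.\<close>

lemma dominates_iff_sub_dom:
  assumes "\<nu> \<in> Par N"
  shows "dominates N \<mu> \<nu> \<longleftrightarrow> sub_dom N \<mu> \<nu>"
proof
  assume d: "dominates N \<mu> \<nu>"
  show "sub_dom N \<mu> \<nu>" unfolding sub_dom_def
  proof (intro conjI allI impI)
    show "psize N \<nu> = psize N \<mu>" using d by (simp add: dominates_def)
    fix S assume S: "S \<subseteq> {1..N}"
    have "card S \<le> N" using card_mono[OF _ S] by simp
    then have "sum \<nu> {1..card S} \<le> sum \<mu> {1..card S}"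
      using d by (cases "card S = 0") (auto simp: dominates_def)
    then show "sum \<nu> S \<le> sum \<mu> {1..card S}" using Par_sum_le[OF assms S] by simp
  qed
next
  assume d: "sub_dom N \<mu> \<nu>"
  have "sum \<nu> {1..k} \<le> sum \<mu> {1..k}" if "k \<in> {1..N}" for k
  proof -
    have "{1..k} \<subseteq> {1..N}" using that by auto
    then show ?thesis using d unfolding sub_dom_def by (metis card_atLeastAtMost diff_Suc_1)
  qed
  then show "dominates N \<mu> \<nu>" using d by (auto simp: dominates_def sub_dom_def)
qed

text \<open>Each of the two partitions dominates the other, so all partial sums agree, and hence
  their differences.\<close>

lemma rearr_Par_unique:
  assumes \<mu>: "\<mu> \<in> Par N" and \<nu>: "\<nu> \<in> Par N" and r: "\<nu> \<in> rearr N \<mu>"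
  shows "\<nu> = \<mu>"
proof -
  have le: "sum \<nu> {1..k} \<le> sum \<mu> {1..k}"
    if "\<mu> \<in> Par N" "\<nu> \<in> rearr N \<mu>" "k \<le> N" for \<mu> \<nu> k
  proof -
    have "sub_dom N \<mu> \<mu>" using Par_sum_le that by (auto simp: sub_dom_def)
    then have "sub_dom N \<mu> \<nu>" using that sub_dom_permutes by (auto simp: rearr_def)
    moreover have "{1..k} \<subseteq> {1..N}" using that by auto
    ultimately show ?thesis unfolding sub_dom_def by (metis card_atLeastAtMost diff_Suc_1)
  qed
  have eq: "sum \<nu> {1..k} = sum \<mu> {1..k}" if "k \<le> N" for k
    using le[OF \<mu> r that] le[OF \<nu> rearr_sym[OF r] that] by simp
  show ?thesis
  proof
    fix i show "\<nu> i = \<mu> i"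
    proof (cases "i \<in> {1..N}")
      case True
      then obtain k where k: "i = Suc k" "Suc k \<le> N" by (cases i) auto
      then show ?thesis using eq[of k] eq[of "Suc k"] by simp
    qed (use \<mu> \<nu> in \<open>auto simp: Par_def\<close>)
  qed
qed

text \<open>Selection sort: a transposition brings a minimal value to the last position, and the
  induction hypothesis sorts the others.\<close>

lemma ex_sorting:
  "\<exists>\<sigma>. \<sigma> permutes {1..N} \<and> (\<forall>i\<in>{1..N::nat}. \<forall>j\<in>{1..N}. i \<le> j \<longrightarrow> (\<gamma> (\<sigma> j) :: nat) \<le> \<gamma> (\<sigma> i))"
proof (induction N arbitrary: \<gamma>)
  case 0
  then show ?case using permutes_id by force
next
  case (Suc N)
  obtain k where k: "k \<in> {1..Suc N}" "\<And>i. i \<in> {1..Suc N} \<Longrightarrow> \<gamma> k \<le> \<gamma> i"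
    using arg_min_if_finite(1)[of "{1..Suc N}" \<gamma>] arg_min_least[of "{1..Suc N}" _ \<gamma>] by auto
  define \<tau> where "\<tau> = Transposition.transpose k (Suc N)"
  have \<tau>: "\<tau> permutes {1..Suc N}" unfolding \<tau>_def using k by (intro permutes_swap_id) auto
  obtain \<sigma> where \<sigma>: "\<sigma> permutes {1..N}"
    "\<forall>i\<in>{1..N}. \<forall>j\<in>{1..N}. i \<le> j \<longrightarrow> (\<gamma> \<circ> \<tau>) (\<sigma> j) \<le> (\<gamma> \<circ> \<tau>) (\<sigma> i)"
    using Suc.IH by blast
  have \<sigma>': "\<sigma> permutes {1..Suc N}" using \<sigma>(1) by (rule permutes_subset) auto
  have p: "\<tau> \<circ> \<sigma> permutes {1..Suc N}" using \<sigma>' \<tau> by (rule permutes_compose)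
  have "\<sigma> (Suc N) = Suc N" using \<sigma>(1) permutes_not_in by force
  then have last: "(\<tau> \<circ> \<sigma>) (Suc N) = k" by (simp add: \<tau>_def)
  have "\<gamma> ((\<tau> \<circ> \<sigma>) j) \<le> \<gamma> ((\<tau> \<circ> \<sigma>) i)" if "i \<in> {1..Suc N}" "j \<in> {1..Suc N}" "i \<le> j" for i j
  proof (cases "j = Suc N")
    case True
    then show ?thesis using last k(2) permutes_in_image[OF p] that by metis
  next
    case False
    then show ?thesis using \<sigma>(2) that by auto
  qed
  then show ?case using p by blast
qed

lemma ex_Par_rearr:
  assumes "\<gamma> \<in> Comp N n"
  obtains \<nu> where "\<nu> \<in> Par N" "\<gamma> \<in> rearr N \<nu>" "psize N \<nu> = n"
proof -
  obtain \<sigma> where \<sigma>: "\<sigma> permutes {1..N}"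
    "\<forall>i\<in>{1..N}. \<forall>j\<in>{1..N}. i \<le> j \<longrightarrow> \<gamma> (\<sigma> j) \<le> \<gamma> (\<sigma> i)"
    using ex_sorting by blast
  have c: "\<gamma> \<circ> \<sigma> \<in> Comp N n" using Comp_permutes[OF \<sigma>(1) assms] .
  then have "\<gamma> \<circ> \<sigma> \<in> Par N" using \<sigma> by (auto simp: Par_def Comp_def)
  moreover have "\<gamma> \<circ> \<sigma> \<in> rearr N \<gamma>" using \<sigma> by (auto simp: rearr_def)
  ultimately show thesis using that rearr_sym c by (auto simp: Comp_def)
qed

text \<open>Abel summation against a decreasing weight.\<close>

lemma dominates_weighted_sum_le:
  fixes w :: "nat \<Rightarrow> nat"
  assumes w: "\<And>i j. 1 \<le> i \<Longrightarrow> i \<le> j \<Longrightarrow> j \<le> N \<Longrightarrow> w j \<le> w i"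
    and d: "\<And>k. k \<le> N \<Longrightarrow> sum \<nu> {1..k} \<le> sum \<mu> {1..k}"
  shows "(\<Sum>i=1..N. w i * \<nu> i) \<le> (\<Sum>i=1..N. w i * \<mu> i)"
proof (cases "N = 0")
  case False
  \<comment> \<open>The boundary term of the summation by parts strengthens the claim enough for
    induction. The induction runs over \<open>int\<close>, where its step is the nonnegativity of
    \<open>w k - w (Suc k)\<close> times the difference of partial sums.\<close>
  have "(\<Sum>i=1..k. w i * \<nu> i) + w k * (sum \<mu> {1..k} - sum \<nu> {1..k}) \<le> (\<Sum>i=1..k. w i * \<mu> i)"
    if "k \<in> {1..N}" for k
  proof -
    have "k \<le> N \<Longrightarrow> int (\<Sum>i=1..k. w i * \<nu> i) + int (w k) * (int (sum \<mu> {1..k}) - int (sum \<nu> {1..k}))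
      \<le> int (\<Sum>i=1..k. w i * \<mu> i)"
    proof (induction k)
      case (Suc k)
      have dk: "int (sum \<nu> {1..k}) \<le> int (sum \<mu> {1..k})"
        using d[of k] Suc by (simp del: of_nat_sum)
      have "(int (w k) - int (w (Suc k))) * (int (sum \<mu> {1..k}) - int (sum \<nu> {1..k})) \<ge> 0"
        using w[of k "Suc k"] dk Suc
        by (cases "k = 0") (simp_all del: of_nat_sum)
      then show ?case using Suc by (simp add: algebra_simps)
    qed simp
    then have "int (\<Sum>i=1..k. w i * \<nu> i) + int (w k) * (int (sum \<mu> {1..k}) - int (sum \<nu> {1..k}))
      \<le> int (\<Sum>i=1..k. w i * \<mu> i)" using that by simp
    moreover have "sum \<nu> {1..k} \<le> sum \<mu> {1..k}" using d that by simp
    ultimately show ?thesis by (metis of_nat_add of_nat_diff of_nat_le_iff of_nat_mult)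
  qed
  from this[of N] False show ?thesis by simp
qed simp

text \<open>In a partition the larger of two parts is the one with the smaller index, which happens
  for \<open>i\<close> in \<open>N - i\<close> pairs, each counted in both orders. The decreasing
  weight \<open>N - i\<close> makes \<open>dominates_weighted_sum_le\<close> applicable.\<close>

lemma summax_Par:
  assumes "\<nu> \<in> Par N"
  shows "summax N \<nu> = 2 * (\<Sum>i=1..N. (N - i) * \<nu> i)"
proof -
  have split: "{1..N} - {i} = {1..<i} \<union> {i<..N}" if "i \<in> {1..N}" for i using that by auto
  have "summax N \<nu> = (\<Sum>i=1..N. (\<Sum>j\<in>{1..<i}. \<nu> j) + (N - i) * \<nu> i)"
    unfolding summax_def
  proof (rule sum.cong)
    fix i assume i: "i \<in> {1..N}"
    have "(\<Sum>j\<in>{1..N} - {i}. max (\<nu> i) (\<nu> j)) =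
        (\<Sum>j\<in>{1..<i}. max (\<nu> i) (\<nu> j)) + (\<Sum>j\<in>{i<..N}. max (\<nu> i) (\<nu> j))"
      unfolding split[OF i] by (rule sum.union_disjoint) auto
    also have "(\<Sum>j\<in>{1..<i}. max (\<nu> i) (\<nu> j)) = (\<Sum>j\<in>{1..<i}. \<nu> j)"
      using assms i by (intro sum.cong) (auto simp: Par_def max_def)
    also have "(\<Sum>j\<in>{i<..N}. max (\<nu> i) (\<nu> j)) = (\<Sum>j\<in>{i<..N}. \<nu> i)"
      using assms i by (intro sum.cong) (auto simp: Par_def intro!: max_absorb1)
    also have "\<dots> = (N - i) * \<nu> i" by simp
    finally show "(\<Sum>j\<in>{1..N} - {i}. max (\<nu> i) (\<nu> j)) = (\<Sum>j\<in>{1..<i}. \<nu> j) + (N - i) * \<nu> i"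
      .
  qed simp
  also have "\<dots> = (\<Sum>i=1..N. \<Sum>j\<in>{1..<i}. \<nu> j) + (\<Sum>i=1..N. (N - i) * \<nu> i)"
    by (rule sum.distrib)
  also have "(\<Sum>i=1..N. \<Sum>j\<in>{1..<i}. \<nu> j) = (\<Sum>j=1..N. \<Sum>i\<in>{j<..N}. \<nu> j)"
    unfolding sum.Sigma[OF finite_atLeastAtMost ballI[OF finite_atLeastLessThan]]
      sum.Sigma[OF finite_atLeastAtMost ballI[OF finite_greaterThanAtMost]]
    by (rule sum.reindex_bij_witness[of _ "\<lambda>(a,b). (b,a)" "\<lambda>(a,b). (b,a)"]) auto
  finally show ?thesis by simp
qed

text \<open>All three quantities are invariant under sorting, so \<open>\<gamma>\<close> may be
  replaced by its sorted form \<open>\<nu>\<close>. Expanding the squared distance of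
  \<open>\<mu>\<close> and \<open>\<nu>\<close> shows that it is at most the gap in
  \<open>sumsq\<close>; this distance is positive off the orbit of \<open>\<mu>\<close>.\<close>

lemma sub_dom_sumsq_summax:
  assumes \<mu>: "\<mu> \<in> Par N" and d: "sub_dom N \<mu> \<gamma>" and \<gamma>: "\<gamma> \<in> Comp N n"
  shows "summax N \<gamma> \<le> summax N \<mu>" "sumsq N \<gamma> \<le> sumsq N \<mu>"
    and "\<gamma> \<notin> rearr N \<mu> \<Longrightarrow> sumsq N \<gamma> < sumsq N \<mu>"
proof -
  obtain \<nu> where \<nu>: "\<nu> \<in> Par N" "\<gamma> \<in> rearr N \<nu>"
    using ex_Par_rearr[OF \<gamma>] by blast
  then obtain \<sigma> where \<sigma>: "\<sigma> permutes {1..N}" "\<gamma> = \<nu> \<circ> \<sigma>" by (auto simp: rearr_def)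
  have dn: "dominates N \<mu> \<nu>"
    using d \<sigma> \<nu> by (simp add: sub_dom_permutes_iff dominates_iff_sub_dom)
  have dk: "sum \<nu> {1..k} \<le> sum \<mu> {1..k}" if "k \<le> N" for k
    using dn that by (cases "k = 0") (auto simp: dominates_def)
  have sq: "sumsq N \<gamma> = sumsq N \<nu>" "summax N \<gamma> = summax N \<nu>"
    using \<sigma> by (simp_all add: sumsq_permutes summax_permutes)
  show "summax N \<gamma> \<le> summax N \<mu>"
    unfolding sq summax_Par[OF \<mu>] summax_Par[OF \<nu>(1)]
    using dominates_weighted_sum_le[of N "\<lambda>i. N - i", OF _ dk] by simp
  \<comment> \<open>The partition \<open>\<nu>\<close> is itself decreasing and serves as its own
    weight.\<close>
  have "(\<Sum>i=1..N. \<nu> i * \<nu> i) \<le> (\<Sum>i=1..N. \<nu> i * \<mu> i)"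
    using \<nu>(1) by (intro dominates_weighted_sum_le dk) (auto simp: Par_def)
  then have "int (\<Sum>i=1..N. \<nu> i * \<nu> i) \<le> int (\<Sum>i=1..N. \<nu> i * \<mu> i)" by linarith
  moreover have "(\<Sum>i=1..N. (int (\<mu> i) - int (\<nu> i))\<^sup>2) =
      int (sumsq N \<mu>) - 2 * int (\<Sum>i=1..N. \<nu> i * \<mu> i) + int (\<Sum>i=1..N. \<nu> i * \<nu> i)"
    by (simp add: sumsq_def power2_eq_square algebra_simps sum.distrib sum_subtractf sum_distrib_left)
  moreover have "int (sumsq N \<nu>) = int (\<Sum>i=1..N. \<nu> i * \<nu> i)"
    by (simp add: sumsq_def power2_eq_square)
  ultimately have main: "int (sumsq N \<nu>) + (\<Sum>i=1..N. (int (\<mu> i) - int (\<nu> i))\<^sup>2) \<le> int (sumsq N \<mu>)"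
    by linarith
  moreover have nn: "(\<Sum>i=1..N. (int (\<mu> i) - int (\<nu> i))\<^sup>2) \<ge> 0" by (intro sum_nonneg) simp
  ultimately show "sumsq N \<gamma> \<le> sumsq N \<mu>" using sq by linarith
  assume "\<gamma> \<notin> rearr N \<mu>"
  then have "\<mu> \<noteq> \<nu>" using \<nu> by auto
  then obtain i where i: "\<mu> i \<noteq> \<nu> i" by blast
  then have "i \<in> {1..N}" using \<mu> \<nu> unfolding Par_def by (metis (mono_tags, lifting) mem_Collect_eq)
  then have "(\<Sum>i=1..N. (int (\<mu> i) - int (\<nu> i))\<^sup>2) \<noteq> 0"
    using i by (subst sum_nonneg_eq_0_iff) auto
  then show "sumsq N \<gamma> < sumsq N \<mu>" using main nn sq by linarith
qed

lemma sub_dom_refl: "\<mu> \<in> Par N \<Longrightarrow> sub_dom N \<mu> \<mu>"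
  using Par_sum_le by (auto simp: sub_dom_def)

lemma sub_dom_rearr: "\<mu> \<in> Par N \<Longrightarrow> \<gamma> \<in> rearr N \<mu> \<Longrightarrow> sub_dom N \<mu> \<gamma>"
  unfolding rearr_def using sub_dom_permutes sub_dom_refl by blast

section \<open>Spreading two parts apart\<close>

lemma sum_remove2:
  "finite A \<Longrightarrow> i \<in> A \<Longrightarrow> j \<in> A \<Longrightarrow> i \<noteq> j \<Longrightarrow> sum g A = g i + (g j + sum g (A - {i} - {j}))"
  by (simp add: sum.remove[of A i] sum.remove[of "A - {i}" j])

lemma psize_spread:
  assumes "i \<in> {1..N}" "j \<in> {1..N}" "i \<noteq> j" "m < min (\<gamma> i) (\<gamma> j)"
  shows "psize N (spread \<gamma> i j m) = psize N \<gamma>"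
proof -
  have "psize N g = g i + g j + sum g ({1..N} - {i} - {j})" for g
    unfolding psize_def using assms by (subst sum_remove2[of _ i j]) auto
  moreover have "sum (spread \<gamma> i j m) ({1..N} - {i} - {j}) = sum \<gamma> ({1..N} - {i} - {j})"
    by (intro sum.cong) (auto simp: spread_def)
  ultimately show ?thesis using assms by (auto simp: spread_def)
qed

lemma spread_Comp:
  assumes "\<gamma> \<in> Comp N n" "i \<in> {1..N}" "j \<in> {1..N}" "i \<noteq> j" "m < min (\<gamma> i) (\<gamma> j)"
  shows "spread \<gamma> i j m \<in> Comp N n"
  using assms psize_spread[OF assms(2-)] by (auto simp: Comp_def spread_def)

text \<open>The exact increment matters, not only its sign: the bound on the Jack coefficients
  telescopes over its differences in \<open>m\<close>.\<close>

lemma sumsq_spread: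
  assumes "i \<in> {1..N}" "j \<in> {1..N}" "i \<noteq> j" "m < min (\<gamma> i) (\<gamma> j)"
  shows "sumsq N (spread \<gamma> i j m) = sumsq N \<gamma> + 2 * (\<gamma> i - m) * (\<gamma> j - m)"
proof -
  have *: "sumsq N g = (g i)\<^sup>2 + (g j)\<^sup>2 + (\<Sum>k\<in>{1..N} - {i} - {j}. (g k)\<^sup>2)" for g
    unfolding sumsq_def using assms by (subst sum_remove2[of _ i j]) auto
  have r: "(\<Sum>k\<in>{1..N} - {i} - {j}. (spread \<gamma> i j m k)\<^sup>2) = (\<Sum>k\<in>{1..N} - {i} - {j}. (\<gamma> k)\<^sup>2)"
    by (intro sum.cong) (auto simp: spread_def)
  obtain a b where "\<gamma> i = m + a" "\<gamma> j = m + b"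
    using assms(4) le_Suc_ex[of m "\<gamma> i"] le_Suc_ex[of m "\<gamma> j"] by auto
  then have "(\<gamma> i + \<gamma> j - m)\<^sup>2 + m\<^sup>2 = (\<gamma> i)\<^sup>2 + (\<gamma> j)\<^sup>2 + 2 * (\<gamma> i - m) * (\<gamma> j - m)"
    by (simp add: power2_eq_square algebra_simps)
  then show ?thesis using assms r by (simp add: * spread_def)
qed

lemma sumsq_spread_less:
  assumes "i \<in> {1..N}" "j \<in> {1..N}" "i \<noteq> j" "m < min (\<gamma> i) (\<gamma> j)"
  shows "sumsq N \<gamma> < sumsq N (spread \<gamma> i j m)"
  using assms by (simp add: sumsq_spread)

text \<open>A sum of \<open>\<gamma>\<close> over \<open>S\<close> is bounded by a sum of the spread
  vector over a set of the same size. If \<open>S\<close> contains \<open>j\<close> but not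
  \<open>i\<close>, that set has \<open>i\<close> in place of \<open>j\<close>, because the large
  part sits at \<open>i\<close>; otherwise it is \<open>S\<close> itself.\<close>

lemma sub_dom_spread:
  assumes ij: "i \<in> {1..N}" "j \<in> {1..N}" "i \<noteq> j" "m < min (\<gamma> i) (\<gamma> j)"
    and d: "sub_dom N \<mu> (spread \<gamma> i j m)"
  shows "sub_dom N \<mu> \<gamma>"
  unfolding sub_dom_def
proof (intro conjI allI impI)
  show "psize N \<gamma> = psize N \<mu>" using d psize_spread[OF ij] by (simp add: sub_dom_def)
  let ?l = "spread \<gamma> i j m"
  have L: "sum ?l S \<le> sum \<mu> {1..card S}" if "S \<subseteq> {1..N}" for S
    using d that by (simp add: sub_dom_def)
  fix S assume S: "S \<subseteq> {1..N}"
  have fS: "finite S" using S finite_subset by blast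
  have same: "sum ?l T = sum \<gamma> T" if "i \<notin> T" "j \<notin> T" for T
    using that by (intro sum.cong) (auto simp: spread_def)
  consider "i \<in> S" "j \<in> S" | "i \<notin> S" "j \<notin> S" | "i \<in> S" "j \<notin> S" | "i \<notin> S" "j \<in> S" by blast
  then show "sum \<gamma> S \<le> sum \<mu> {1..card S}"
  proof cases
    case 1
    have r: "sum g S = g i + g j + sum g (S - {i} - {j})" for g :: "nat \<Rightarrow> nat"
      using fS 1 ij by (subst sum_remove2[of _ i j]) auto
    have "sum \<gamma> S = sum ?l S"
      using r[of \<gamma>] r[of ?l] same[of "S - {i} - {j}"] ij by (simp add: spread_def)
    then show ?thesis using L[OF S] by simp
  next
    case 2
    then show ?thesis using L[OF S] same by simp
  next
    case 3
    have l: "\<gamma> i \<le> ?l i" using ij by (auto simp: spread_def)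
    have "sum \<gamma> S = \<gamma> i + sum \<gamma> (S - {i})" using fS 3 by (simp add: sum.remove)
    also have "\<dots> \<le> ?l i + sum ?l (S - {i})" using l same[of "S - {i}"] 3 by simp
    also have "\<dots> = sum ?l S" using fS 3 by (simp add: sum.remove)
    finally show ?thesis using L[OF S] by simp
  next
    case 4
    have l: "\<gamma> j \<le> ?l i" using ij by (auto simp: spread_def)
    have "sum \<gamma> S = \<gamma> j + sum \<gamma> (S - {j})" using fS 4 by (simp add: sum.remove)
    also have "\<dots> \<le> ?l i + sum ?l (S - {j})" using l same[of "S - {j}"] 4 by simp
    also have "\<dots> = sum ?l (insert i (S - {j}))" using fS 4 by simp
    also have "\<dots> \<le> sum \<mu> {1..card (insert i (S - {j}))}" using ij S by (intro L) auto
    also have "card (insert i (S - {j})) = Suc (card (S - {j}))"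
      using fS 4 by (intro card_insert_disjoint) auto
    also have "\<dots> = card S" by (rule card_Suc_Diff1[OF fS 4(2)])
    finally show ?thesis .
  qed
qed

lemma spread_permutes:
  assumes "inj \<sigma>"
  shows "spread (\<gamma> \<circ> \<sigma>) i j m = spread \<gamma> (\<sigma> i) (\<sigma> j) m \<circ> \<sigma>"
  unfolding spread_def fun_eq_iff comp_def fun_upd_def inj_eq[OF assms] by simp

subsection \<open>The Laplace--Beltrami operator on coefficients\<close>

lemma base_expansion_inj:
  fixes \<beta> \<gamma> :: "nat \<Rightarrow> nat"
  assumes "\<And>i. i \<in> {1..N} \<Longrightarrow> \<beta> i < B" "\<And>i. i \<in> {1..N} \<Longrightarrow> \<gamma> i < B"
    and "(\<Sum>i=1..N. \<beta> i * B ^ i) = (\<Sum>i=1..N. \<gamma> i * B ^ i)"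
  shows "\<forall>i\<in>{1..N}. \<beta> i = \<gamma> i"
  using assms
proof (induction N)
  case (Suc N)
  \<comment> \<open>The digits below the top one contribute less than one unit of the top position,
    so \<open>div\<close> recovers the top digit.\<close>
  have lt: "(\<Sum>i=1..N. g i * B ^ i) < B ^ Suc N" if "\<And>i. i \<in> {1..N} \<Longrightarrow> g i < B" "B > 0"
    for g :: "nat \<Rightarrow> nat"
    using that
  proof (induction N)
    case (Suc N)
    have "(\<Sum>i=1..Suc N. g i * B ^ i) < B ^ Suc N + g (Suc N) * B ^ Suc N"
      using Suc by simp
    also have "\<dots> = (1 + g (Suc N)) * B ^ Suc N" by (simp add: algebra_simps)
    also have "\<dots> \<le> B * B ^ Suc N" using Suc.prems(1)[of "Suc N"] by (intro mult_right_mono) auto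
    finally show ?case by simp
  qed simp
  have B: "B > 0" using Suc.prems(1)[of "Suc N"] by simp
  let ?s = "\<lambda>g. (\<Sum>i=1..N. g i * B ^ i)"
  have l: "?s \<beta> < B ^ Suc N" "?s \<gamma> < B ^ Suc N"
    using Suc.prems(1,2) B by (intro lt; auto)+
  have eq: "?s \<beta> + \<beta> (Suc N) * B ^ Suc N = ?s \<gamma> + \<gamma> (Suc N) * B ^ Suc N"
    using Suc.prems(3) by simp
  have "\<beta> (Suc N) = (?s \<beta> + \<beta> (Suc N) * B ^ Suc N) div B ^ Suc N"
    using l B by (simp add: div_mult_self1)
  also have "\<dots> = \<gamma> (Suc N)" unfolding eq using l B by (simp add: div_mult_self1)
  finally have last: "\<beta> (Suc N) = \<gamma> (Suc N)" .
  then have "\<forall>i\<in>{1..N}. \<beta> i = \<gamma> i" using eq Suc by auto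
  then show ?case using last by (auto simp: le_Suc_eq)
qed simp

definition mon :: "nat \<Rightarrow> (nat \<Rightarrow> nat) \<Rightarrow> (nat \<Rightarrow> complex) \<Rightarrow> complex" where
  "mon N \<beta> y = (\<Prod>i=1..N. y i ^ \<beta> i)"

text \<open>Kronecker substitution: \<open>y i = z ^ (B ^ i)\<close> separates the monomials with exponents below \<open>B\<close>.\<close>

lemma mon_lin_indep:
  assumes z: "\<And>y. inj_on y {1..N} \<Longrightarrow> (\<Sum>\<gamma>\<in>Comp N n. d \<gamma> * mon N \<gamma> y) = 0"
    and \<gamma>: "\<gamma> \<in> Comp N n"
  shows "d \<gamma> = 0"
proof -
  \<comment> \<open>Exponents are at most \<open>n\<close>, so they are digits in this base;
    \<open>n + 2\<close> also keeps \<open>B\<close> at least \<open>2\<close> when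
    \<open>n = 0\<close>, as the injectivity of \<open>B ^ i\<close> in \<open>i\<close>
    requires.\<close>
  define B where "B = n + 2"
  define e where "e \<beta> = (\<Sum>i=1..N. \<beta> i * B ^ i)" for \<beta>
  define p where "p = (\<Sum>\<gamma>\<in>Comp N n. monom (d \<gamma>) (e \<gamma>))"
  have inj: "inj_on e (Comp N n)"
  proof (rule inj_onI)
    fix \<beta> \<gamma> assume *: "\<beta> \<in> Comp N n" "\<gamma> \<in> Comp N n" "e \<beta> = e \<gamma>"
    then have "\<forall>i\<in>{1..N}. \<beta> i = \<gamma> i"
      using Comp_le[of _ N n] unfolding e_def B_def
      by (intro base_expansion_inj) (auto simp: less_Suc_eq_le le_SucI)
    then show "\<beta> = \<gamma>" using * by (auto simp: Comp_def fun_eq_iff)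
  qed
  \<comment> \<open>Real \<open>z > 1\<close> have distinct powers, so the point has distinct
    coordinates, and there are infinitely many of them.\<close>
  have "poly p (of_real z) = 0" if "z > 1" for z :: real
  proof -
    define y where "y = (\<lambda>i. (of_real z :: complex) ^ (B ^ i))"
    have "inj_on y {1..N}"
    proof (rule inj_onI)
      fix i j assume "y i = y j"
      then have "of_real (z ^ B ^ i) = (of_real (z ^ B ^ j) :: complex)" by (simp add: y_def)
      then have "z ^ B ^ i = z ^ B ^ j" using of_real_eq_iff by blast
      then have "B ^ i = B ^ j" using that by (simp add: power_inject_exp)
      then show "i = j" by (simp add: B_def)
    qed
    from z[OF this] have "(\<Sum>\<gamma>\<in>Comp N n. d \<gamma> * mon N \<gamma> y) = 0" .
    moreover have "mon N \<gamma> y = of_real z ^ e \<gamma>" for \<gamma>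
      by (simp add: mon_def y_def e_def power_sum mult.commute flip: power_mult)
    ultimately show ?thesis by (simp add: p_def poly_sum poly_monom)
  qed
  then have "of_real ` {1<..} \<subseteq> {z. poly p z = 0}" by auto
  moreover have "infinite (of_real ` {1<..} :: complex set)"
    using infinite_Ioi[of "1::real"] by (simp add: finite_image_iff inj_on_def)
  ultimately have "p = 0" using poly_roots_finite finite_subset by blast
  then have "0 = coeff p (e \<gamma>)" by simp
  also have "\<dots> = (\<Sum>\<beta>\<in>Comp N n. if \<beta> = \<gamma> then d \<beta> else 0)"
    unfolding p_def coeff_sum using inj \<gamma> by (intro sum.cong) (auto simp: inj_on_def)
  also have "\<dots> = d \<gamma>" using \<gamma> by simp
  finally show ?thesis by simp
qed

text \<open>The exponents pass through \<open>h\<close> so that the rule applies again to its own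
  result, which yields the second derivative. Where \<open>h \<beta> i = 0\<close> the truncated
  exponent is harmless, since the coefficient vanishes.\<close>

lemma partial_mon_sum:
  assumes i: "i \<in> {1..N}"
  shows "partial i (\<lambda>y. \<Sum>\<beta>\<in>S. c \<beta> * mon N (h \<beta>) y)
    = (\<lambda>y. \<Sum>\<beta>\<in>S. (c \<beta> * of_nat (h \<beta> i)) * mon N ((h \<beta>)(i := h \<beta> i - 1)) y)"
proof
  fix y
  have m: "mon N \<beta> (y(i := t)) = t ^ \<beta> i * (\<Prod>k\<in>{1..N} - {i}. y k ^ \<beta> k)" for \<beta> t y
  proof -
    have "mon N \<beta> (y(i := t)) = t ^ \<beta> i * (\<Prod>k\<in>{1..N} - {i}. (y(i := t)) k ^ \<beta> k)"
      unfolding mon_def using i by (subst prod.remove[of _ i]) auto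
    also have "(\<Prod>k\<in>{1..N} - {i}. (y(i := t)) k ^ \<beta> k) = (\<Prod>k\<in>{1..N} - {i}. y k ^ \<beta> k)"
      by (rule prod.cong) auto
    finally show ?thesis .
  qed
  have m': "mon N (\<beta>(i := k)) y = y i ^ k * (\<Prod>k\<in>{1..N} - {i}. y k ^ \<beta> k)" for \<beta> k
  proof -
    have "mon N (\<beta>(i := k)) y = y i ^ k * (\<Prod>l\<in>{1..N} - {i}. y l ^ (\<beta>(i := k)) l)"
      unfolding mon_def using i by (subst prod.remove[of _ i]) auto
    also have "(\<Prod>l\<in>{1..N} - {i}. y l ^ (\<beta>(i := k)) l) = (\<Prod>k\<in>{1..N} - {i}. y k ^ \<beta> k)"
      by (rule prod.cong) auto
    finally show ?thesis .
  qed
  show "partial i (\<lambda>y. \<Sum>\<beta>\<in>S. c \<beta> * mon N (h \<beta>) y) y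
      = (\<Sum>\<beta>\<in>S. (c \<beta> * of_nat (h \<beta> i)) * mon N ((h \<beta>)(i := h \<beta> i - 1)) y)"
    unfolding partial_def m m'
    by (rule DERIV_imp_deriv) (auto intro!: derivative_eq_intros simp: mult_ac)
qed

lemma mon_reduce:
  assumes i: "i \<in> {1..N}"
  shows "of_nat (\<beta> i) * (y i * mon N (\<beta>(i := \<beta> i - 1)) y) = of_nat (\<beta> i) * mon N \<beta> y"
proof (cases "\<beta> i")
  case (Suc k)
  have "y i * mon N (\<beta>(i := \<beta> i - 1)) y = y i * (y i ^ k * (\<Prod>l\<in>{1..N} - {i}. y l ^ (\<beta>(i := k)) l))"
    unfolding mon_def using i Suc by (subst prod.remove[of _ i]) auto
  also have "(\<Prod>l\<in>{1..N} - {i}. y l ^ (\<beta>(i := k)) l) = (\<Prod>l\<in>{1..N} - {i}. y l ^ \<beta> l)"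
    by (rule prod.cong) auto
  also have "y i * (y i ^ k * (\<Prod>l\<in>{1..N} - {i}. y l ^ \<beta> l)) = mon N \<beta> y"
    unfolding mon_def using i Suc by (subst prod.remove[of _ i]) auto
  finally show ?thesis by (rule arg_cong)
qed simp

lemma partial1_mon_sum:
  assumes i: "i \<in> {1..N}"
  shows "y i * partial i (\<lambda>y. \<Sum>\<beta>\<in>S. c \<beta> * mon N \<beta> y) y
    = (\<Sum>\<beta>\<in>S. c \<beta> * of_nat (\<beta> i) * mon N \<beta> y)"
proof -
  have "y i * partial i (\<lambda>y. \<Sum>\<beta>\<in>S. c \<beta> * mon N \<beta> y) y
      = (\<Sum>\<beta>\<in>S. c \<beta> * (of_nat (\<beta> i) * (y i * mon N (\<beta>(i := \<beta> i - 1)) y)))"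
    unfolding partial_mon_sum[OF i, where h = "\<lambda>\<beta>. \<beta>"] by (simp add: sum_distrib_left mult_ac)
  then show ?thesis unfolding mon_reduce[OF i] by (simp add: mult_ac)
qed

lemma partial2_mon_sum:
  assumes i: "i \<in> {1..N}"
  shows "(y i)\<^sup>2 * partial i (partial i (\<lambda>y. \<Sum>\<beta>\<in>S. c \<beta> * mon N \<beta> y)) y
    = (\<Sum>\<beta>\<in>S. c \<beta> * of_nat (\<beta> i * (\<beta> i - 1)) * mon N \<beta> y)"
proof -
  have *: "of_nat (\<beta> i) * (of_nat (\<beta> i - 1) * (y i * (y i * mon N (\<beta>(i := \<beta> i - 1 - 1)) y)))
      = of_nat (\<beta> i) * (of_nat (\<beta> i - 1) * mon N \<beta> y)" for \<beta>
  proof -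
    have "of_nat (\<beta> i - 1) * (y i * mon N (\<beta>(i := \<beta> i - 1 - 1)) y)
        = of_nat (\<beta> i - 1) * mon N (\<beta>(i := \<beta> i - 1)) y"
      using mon_reduce[OF i, of "\<beta>(i := \<beta> i - 1)" y] by simp
    then have "of_nat (\<beta> i) * (of_nat (\<beta> i - 1) * (y i * (y i * mon N (\<beta>(i := \<beta> i - 1 - 1)) y)))
      = of_nat (\<beta> i) * (y i * (of_nat (\<beta> i - 1) * mon N (\<beta>(i := \<beta> i - 1)) y))"
      by (simp add: mult_ac)
    also have "\<dots> = of_nat (\<beta> i - 1) * (of_nat (\<beta> i) * (y i * mon N (\<beta>(i := \<beta> i - 1)) y))"
      by (simp add: mult_ac)
    finally show ?thesis unfolding mon_reduce[OF i] by (simp add: mult_ac)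
  qed
  have "(y i)\<^sup>2 * partial i (partial i (\<lambda>y. \<Sum>\<beta>\<in>S. c \<beta> * mon N \<beta> y)) y
    = (\<Sum>\<beta>\<in>S. c \<beta> * (of_nat (\<beta> i) * (of_nat (\<beta> i - 1) * (y i * (y i * mon N (\<beta>(i := \<beta> i - 1 - 1)) y)))))"
    unfolding partial_mon_sum[OF i, where h = "\<lambda>\<beta>. \<beta>"] partial_mon_sum[OF i]
    by (simp add: sum_distrib_left mult_ac power2_eq_square)
  then show ?thesis unfolding * by (simp add: mult_ac)
qed

section \<open>The first-order part for one pair of variables\<close>

text \<open>The right-hand side comes from dividing the left-hand side, symmetrised in \<open>k\<close>, by \<open>Y - Z\<close>.\<close>

lemma two_variable_identity:
  fixes g :: "nat \<Rightarrow> 'a :: comm_ring_1"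
  assumes sym: "\<And>k. k \<le> s \<Longrightarrow> g (s - k) = g k"
  shows "(\<Sum>k\<le>s. g k * (of_nat k * Y - of_nat (s - k) * Z) * (Y ^ k * Z ^ (s - k))) =
    (Y - Z) * (\<Sum>k\<le>s. (of_nat (max k (s - k)) * g k + (\<Sum>m<min k (s - k). of_nat (s - 2 * m) * g m))
                 * (Y ^ k * Z ^ (s - k)))"
proof -
  define G where "G k = of_nat (max k (s - k)) * g k + (\<Sum>m<min k (s - k). of_nat (s - 2 * m) * g m)" for k
  have shift: "(\<Sum>k\<le>s. u k * (Y ^ Suc k * Z ^ (s - k))) - (\<Sum>k\<le>s. v k * (Y ^ k * Z ^ (Suc s - k)))
     = u s * Y ^ Suc s - v 0 * Z ^ Suc s + (\<Sum>k<s. (u k - v (Suc k)) * (Y ^ Suc k * Z ^ (s - k)))"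
    for u v :: "nat \<Rightarrow> 'a"
  proof -
    have "(\<Sum>k\<le>s. u k * (Y ^ Suc k * Z ^ (s - k)))
        = u s * Y ^ Suc s + (\<Sum>k<s. u k * (Y ^ Suc k * Z ^ (s - k)))"
      by (simp add: lessThan_Suc_atMost[symmetric] add.commute)
    moreover have "(\<Sum>k\<le>s. v k * (Y ^ k * Z ^ (Suc s - k)))
        = v 0 * Z ^ Suc s + (\<Sum>k<s. v (Suc k) * (Y ^ Suc k * Z ^ (s - k)))"
      by (simp add: lessThan_Suc_atMost[symmetric] sum.lessThan_Suc_shift del: sum.lessThan_Suc)
    ultimately show ?thesis by (simp add: sum_subtractf algebra_simps)
  qed
  \<comment> \<open>Comparison of the coefficients of \<open>Y ^ Suc k * Z ^ (s - k)\<close>. From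
    \<open>k\<close> to \<open>Suc k\<close> the inner sum loses its last term in the upper half of
    the range, gains one in the lower half, and stays the same at the middle, where symmetry gives
    \<open>g (Suc k) = g k\<close>.\<close>
  have c: "of_nat k * g k - of_nat (s - Suc k) * g (Suc k) = G k - G (Suc k)" if k: "k < s" for k
  proof -
    consider "s - Suc k \<le> k" "s - k \<le> k" | "k \<le> s - Suc k" "Suc k \<le> s - Suc k" | "s = 2 * k + 1"
      using k by linarith
    then show ?thesis
    proof cases
      case 1
      define d where "d = s - Suc k"
      have d: "s - k = Suc d" "s = Suc (k + d)" "d < k" using 1 k by (auto simp: d_def)
      have gd: "g d = g (Suc k)" using sym[of "Suc k"] k by (simp add: d_def)
      have *: "(of_nat (s - 2 * d) :: 'a) = of_nat (Suc k) - of_nat d"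
        using d by (simp flip: of_nat_diff del: of_nat_Suc)
      have "G k - G (Suc k) = of_nat k * g k - of_nat (Suc k) * g (Suc k) + of_nat (s - 2 * d) * g d"
      proof -
        have "max k (s - k) = k" "min k (s - k) = Suc d" "max (Suc k) (s - Suc k) = Suc k"
          "min (Suc k) (s - Suc k) = d" using d by auto
        then show ?thesis by (simp add: G_def del: of_nat_Suc of_nat_diff)
      qed
      then show ?thesis unfolding * gd d_def[symmetric] by (simp add: algebra_simps)
    next
      case 2
      define d where "d = s - Suc k"
      have d: "s - k = Suc d" "s = Suc (k + d)" "Suc k \<le> d" using 2 k by (auto simp: d_def)
      have *: "(of_nat (s - 2 * k) :: 'a) = of_nat (Suc d) - of_nat k"
        using d by (simp flip: of_nat_diff del: of_nat_Suc)
      have "G k - G (Suc k) = of_nat (Suc d) * g k - of_nat d * g (Suc k) - of_nat (s - 2 * k) * g k"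
        using d by (simp add: G_def max_def min_def d_def[symmetric] del: of_nat_Suc of_nat_diff)
      then show ?thesis unfolding * d_def[symmetric] by (simp add: algebra_simps)
    next
      case 3
      then have "g (Suc k) = g k" using sym[of "Suc k"] by simp
      then show ?thesis using 3 by (simp add: G_def max_def min_def algebra_simps)
    qed
  qed
  have "(\<Sum>k\<le>s. g k * (of_nat k * Y - of_nat (s - k) * Z) * (Y ^ k * Z ^ (s - k)))
     = (\<Sum>k\<le>s. (of_nat k * g k) * (Y ^ Suc k * Z ^ (s - k)))
      - (\<Sum>k\<le>s. (of_nat (s - k) * g k) * (Y ^ k * Z ^ (Suc s - k)))"
    unfolding sum_subtractf[symmetric]
    by (rule sum.cong) (auto simp: Suc_diff_le algebra_simps simp del: of_nat_diff)
  also have "\<dots> = (\<Sum>k\<le>s. G k * (Y ^ Suc k * Z ^ (s - k))) - (\<Sum>k\<le>s. G k * (Y ^ k * Z ^ (Suc s - k)))"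
    unfolding shift using c by (simp add: G_def del: of_nat_diff)
  also have "\<dots> = (Y - Z) * (\<Sum>k\<le>s. G k * (Y ^ k * Z ^ (s - k)))"
    unfolding sum_distrib_left sum_subtractf[symmetric]
    by (rule sum.cong) (auto simp: Suc_diff_le algebra_simps)
  finally show ?thesis by (simp add: G_def)
qed

text \<open>The off-diagonal part of the operator without its factor \<open>\<theta>\<close>.
  Summing over ordered pairs absorbs the factor \<open>2\<close> in \<open>laplace_beltrami\<close>.
  The type is left open because both real Jack coefficients and arbitrary complex ones are
  inserted.\<close>

definition lbsum :: "nat \<Rightarrow> ((nat \<Rightarrow> nat) \<Rightarrow> 'a :: semiring_1) \<Rightarrow> (nat \<Rightarrow> nat) \<Rightarrow> 'a" where
  "lbsum N f \<gamma> = (\<Sum>i=1..N. \<Sum>j\<in>{1..N} - {i}. \<Sum>m<min (\<gamma> i) (\<gamma> j).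
     of_nat (\<gamma> i + \<gamma> j - 2 * m) * f (spread \<gamma> i j m))"

text \<open>On a partition, by \<open>summax_Par\<close>, this is the classical Jack eigenvalue: the
  sum of \<open>\<mu> i * (\<mu> i - 1)\<close> plus \<open>2 * \<theta>\<close> times the sum of
  \<open>(N - i) * \<mu> i\<close>.\<close>

definition lbeig :: "nat \<Rightarrow> real \<Rightarrow> (nat \<Rightarrow> nat) \<Rightarrow> real" where
  "lbeig N \<theta> \<gamma> = real (sumsq N \<gamma>) - real (psize N \<gamma>) + \<theta> * real (summax N \<gamma>)"

text \<open>Exponent vectors are grouped by their entries away from \<open>i\<close> and
  \<open>j\<close> together with the sum of the two entries there. On each group the claim is
  \<open>two_variable_identity\<close>, whose symmetry hypothesis is the invariance of
  \<open>f\<close> under the transposition of \<open>i\<close> and \<open>j\<close>.\<close>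

lemma pair_operator:
  fixes f :: "(nat \<Rightarrow> nat) \<Rightarrow> complex"
  assumes i: "i \<in> {1..N}" and j: "j \<in> {1..N}" and ij: "i \<noteq> j"
    and sym: "\<And>\<sigma> \<gamma>. \<sigma> permutes {1..N} \<Longrightarrow> \<gamma> \<in> Comp N n \<Longrightarrow> f (\<gamma> \<circ> \<sigma>) = f \<gamma>"
  shows "(\<Sum>\<gamma>\<in>Comp N n. f \<gamma> * (of_nat (\<gamma> i) * y i - of_nat (\<gamma> j) * y j) * mon N \<gamma> y) =
    (y i - y j) * (\<Sum>\<gamma>\<in>Comp N n. (of_nat (max (\<gamma> i) (\<gamma> j)) * f \<gamma> +
      (\<Sum>m<min (\<gamma> i) (\<gamma> j). of_nat (\<gamma> i + \<gamma> j - 2 * m) * f (spread \<gamma> i j m))) * mon N \<gamma> y)"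
proof -
  \<comment> \<open>The representative of a group stores the sum of the two exponents at
    \<open>i\<close>; \<open>?put \<kappa> k\<close> splits it again as \<open>k\<close> and
    \<open>\<kappa> i - k\<close>.\<close>
  define key :: "(nat \<Rightarrow> nat) \<Rightarrow> nat \<Rightarrow> nat" where "key \<gamma> = \<gamma>(i := \<gamma> i + \<gamma> j, j := 0)" for \<gamma>
  define R where "R \<kappa> = (\<Prod>l\<in>{1..N} - {i} - {j}. y l ^ \<kappa> l)" for \<kappa> :: "nat \<Rightarrow> nat"
  let ?put = "\<lambda>\<kappa> k. (\<kappa> :: nat \<Rightarrow> nat)(i := k, j := \<kappa> i - k)"
  have ps: "psize N g = g i + (g j + sum g ({1..N} - {i} - {j}))" for g
    unfolding psize_def using i j ij by (intro sum_remove2) auto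
  have ps_eq: "psize N g = psize N h" if "g i + g j = h i + h j" "\<And>l. l \<noteq> i \<Longrightarrow> l \<noteq> j \<Longrightarrow> g l = h l" for g h
  proof -
    have "sum g ({1..N} - {i} - {j}) = sum h ({1..N} - {i} - {j})" using that by (intro sum.cong) auto
    then show ?thesis using that by (simp add: ps)
  qed
  have fib: "{\<gamma> \<in> Comp N n. key \<gamma> = \<kappa>} = ?put \<kappa> ` {..\<kappa> i}" if \<kappa>: "\<kappa> \<in> key ` Comp N n" for \<kappa>
  proof -
    obtain \<delta> where g0: "\<delta> \<in> Comp N n" "\<kappa> = key \<delta>" using \<kappa> by blast
    show ?thesis
    proof (intro equalityI subsetI)
      fix \<gamma> assume "\<gamma> \<in> {\<gamma> \<in> Comp N n. key \<gamma> = \<kappa>}"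
      then have k: "key \<gamma> = \<kappa>" by simp
      have "\<gamma> = ?put \<kappa> (\<gamma> i)" "\<gamma> i \<le> \<kappa> i"
        using ij by (auto simp: k[symmetric] key_def fun_eq_iff)
      then show "\<gamma> \<in> ?put \<kappa> ` {..\<kappa> i}" by blast
    next
      fix \<gamma> assume "\<gamma> \<in> ?put \<kappa> ` {..\<kappa> i}"
      then obtain k where k: "k \<le> \<kappa> i" "\<gamma> = ?put \<kappa> k" by blast
      have "psize N \<gamma> = psize N \<delta>"
        using k ij by (intro ps_eq) (auto simp: g0 key_def)
      moreover have "\<forall>l. l \<notin> {1..N} \<longrightarrow> \<gamma> l = 0"
        using g0(1) i j unfolding k(2) g0(2) key_def Comp_def by auto
      ultimately have "\<gamma> \<in> Comp N n" using g0(1) unfolding Comp_def by simp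
      moreover have "key \<gamma> = \<kappa>"
        using k(1) ij unfolding k(2) g0(2) key_def by (auto simp: fun_eq_iff)
      ultimately show "\<gamma> \<in> {\<gamma> \<in> Comp N n. key \<gamma> = \<kappa>}" by simp
    qed
  qed
  have split: "(\<Sum>\<gamma>\<in>Comp N n. h \<gamma>) = (\<Sum>\<kappa>\<in>key ` Comp N n. \<Sum>k\<le>\<kappa> i. h (?put \<kappa> k))"
    for h :: "(nat \<Rightarrow> nat) \<Rightarrow> complex"
  proof -
    have "(\<Sum>\<gamma>\<in>Comp N n. h \<gamma>) = (\<Sum>\<kappa>\<in>key ` Comp N n. \<Sum>\<gamma>\<in>{\<gamma> \<in> Comp N n. key \<gamma> = \<kappa>}. h \<gamma>)"
      by (rule sum.image_gen) simp
    also have "\<dots> = (\<Sum>\<kappa>\<in>key ` Comp N n. \<Sum>k\<le>\<kappa> i. h (?put \<kappa> k))"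
    proof (rule sum.cong)
      fix \<kappa> assume \<kappa>: "\<kappa> \<in> key ` Comp N n"
      have "inj_on (?put \<kappa>) {..\<kappa> i}"
      proof (rule inj_onI)
        fix k l assume "?put \<kappa> k = ?put \<kappa> l"
        from fun_cong[OF this, of i] ij show "k = l" by simp
      qed
      then show "(\<Sum>\<gamma>\<in>{\<gamma> \<in> Comp N n. key \<gamma> = \<kappa>}. h \<gamma>) = (\<Sum>k\<le>\<kappa> i. h (?put \<kappa> k))"
        unfolding fib[OF \<kappa>] by (simp add: sum.reindex)
    qed simp
    finally show ?thesis .
  qed
  have mon: "mon N g y = y i ^ g i * y j ^ g j * R g" for g
  proof -
    have "mon N g y = y i ^ g i * (\<Prod>l\<in>{1..N} - {i}. y l ^ g l)"
      unfolding mon_def using i by (intro prod.remove) auto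
    also have "(\<Prod>l\<in>{1..N} - {i}. y l ^ g l) = y j ^ g j * R g"
      unfolding R_def using j ij by (intro prod.remove) auto
    finally show ?thesis by (simp add: mult.assoc)
  qed
  have R: "R (?put \<kappa> k) = R \<kappa>" for \<kappa> k unfolding R_def by (intro prod.cong) auto
  have "(\<Sum>\<gamma>\<in>Comp N n. f \<gamma> * (of_nat (\<gamma> i) * y i - of_nat (\<gamma> j) * y j) * mon N \<gamma> y)
    = (\<Sum>\<kappa>\<in>key ` Comp N n. R \<kappa> * (\<Sum>k\<le>\<kappa> i. f (?put \<kappa> k) *
        (of_nat k * y i - of_nat (\<kappa> i - k) * y j) * (y i ^ k * y j ^ (\<kappa> i - k))))"
    unfolding split mon R sum_distrib_left using ij
    by (intro sum.cong) (auto simp: mult_ac)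
  also have "\<dots> = (\<Sum>\<kappa>\<in>key ` Comp N n. R \<kappa> * ((y i - y j) * (\<Sum>k\<le>\<kappa> i.
      (of_nat (max k (\<kappa> i - k)) * f (?put \<kappa> k) + (\<Sum>m<min k (\<kappa> i - k). of_nat (\<kappa> i - 2 * m) * f (?put \<kappa> m)))
        * (y i ^ k * y j ^ (\<kappa> i - k)))))"
  proof (rule sum.cong)
    fix \<kappa> assume \<kappa>: "\<kappa> \<in> key ` Comp N n"
    have "f (?put \<kappa> (\<kappa> i - k)) = f (?put \<kappa> k)" if "k \<le> \<kappa> i" for k
    proof -
      have "?put \<kappa> (\<kappa> i - k) = ?put \<kappa> k \<circ> Transposition.transpose i j"
        using that ij by (auto simp: fun_eq_iff Transposition.transpose_def)
      moreover have "?put \<kappa> k \<in> Comp N n" using fib[OF \<kappa>] that by blast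
      moreover have "Transposition.transpose i j permutes {1..N}" using i j by (rule permutes_swap_id)
      ultimately show ?thesis using sym by simp
    qed
    note * = two_variable_identity[of "\<kappa> i" "\<lambda>k. f (?put \<kappa> k)" "y i" "y j", OF this]
    show "R \<kappa> * (\<Sum>k\<le>\<kappa> i. f (?put \<kappa> k) *
        (of_nat k * y i - of_nat (\<kappa> i - k) * y j) * (y i ^ k * y j ^ (\<kappa> i - k))) =
       R \<kappa> * ((y i - y j) * (\<Sum>k\<le>\<kappa> i.
      (of_nat (max k (\<kappa> i - k)) * f (?put \<kappa> k) + (\<Sum>m<min k (\<kappa> i - k). of_nat (\<kappa> i - 2 * m) * f (?put \<kappa> m)))
        * (y i ^ k * y j ^ (\<kappa> i - k))))"
      by (rule arg_cong[OF *])
  qed simp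
  also have "\<dots> = (y i - y j) * (\<Sum>\<kappa>\<in>key ` Comp N n. \<Sum>k\<le>\<kappa> i.
      (of_nat (max k (\<kappa> i - k)) * f (?put \<kappa> k) + (\<Sum>m<min k (\<kappa> i - k). of_nat (\<kappa> i - 2 * m) * f (?put \<kappa> m)))
        * (y i ^ k * y j ^ (\<kappa> i - k) * R \<kappa>))"
    unfolding sum_distrib_left
    by (intro sum.cong refl) (simp only: mult_ac)
  also have "(\<Sum>\<kappa>\<in>key ` Comp N n. \<Sum>k\<le>\<kappa> i.
      (of_nat (max k (\<kappa> i - k)) * f (?put \<kappa> k) + (\<Sum>m<min k (\<kappa> i - k). of_nat (\<kappa> i - 2 * m) * f (?put \<kappa> m)))
        * (y i ^ k * y j ^ (\<kappa> i - k) * R \<kappa>)) =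
     (\<Sum>\<gamma>\<in>Comp N n. (of_nat (max (\<gamma> i) (\<gamma> j)) * f \<gamma> +
      (\<Sum>m<min (\<gamma> i) (\<gamma> j). of_nat (\<gamma> i + \<gamma> j - 2 * m) * f (spread \<gamma> i j m))) * mon N \<gamma> y)"
    unfolding split mon R
  proof (intro sum.cong refl)
    fix \<kappa> k assume \<kappa>: "\<kappa> \<in> key ` Comp N n" and k: "k \<in> {..\<kappa> i}"
    \<comment> \<open>\<open>spread\<close> puts the larger part at \<open>i\<close>, while
      \<open>?put \<kappa> m\<close> puts \<open>m\<close> there; symmetry of \<open>f\<close>
      bridges the difference.\<close>
    have sp: "f (spread (?put \<kappa> k) i j m) = f (?put \<kappa> m)" if "m < min k (\<kappa> i - k)" for m
    proof -
      have "spread (?put \<kappa> k) i j m = ?put \<kappa> m \<circ> Transposition.transpose i j"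
        using that ij k by (auto simp: fun_eq_iff Transposition.transpose_def spread_def)
      moreover have "?put \<kappa> m \<in> Comp N n"
      proof -
        have "m \<in> {..\<kappa> i}" using that k by auto
        then show ?thesis using fib[OF \<kappa>] by blast
      qed
      moreover have "Transposition.transpose i j permutes {1..N}" using i j by (rule permutes_swap_id)
      ultimately show ?thesis using sym by simp
    qed
    have e: "?put \<kappa> k i = k" "?put \<kappa> k j = \<kappa> i - k" using ij by auto
    have "k + (\<kappa> i - k) = \<kappa> i" using k by simp
    then show "(of_nat (max k (\<kappa> i - k)) * f (?put \<kappa> k) + (\<Sum>m<min k (\<kappa> i - k). of_nat (\<kappa> i - 2 * m) * f (?put \<kappa> m)))
        * (y i ^ k * y j ^ (\<kappa> i - k) * R \<kappa>) =
      (of_nat (max (?put \<kappa> k i) (?put \<kappa> k j)) * f (?put \<kappa> k) +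
      (\<Sum>m<min (?put \<kappa> k i) (?put \<kappa> k j). of_nat (?put \<kappa> k i + ?put \<kappa> k j - 2 * m) * f (spread (?put \<kappa> k) i j m)))
       * (y i ^ ?put \<kappa> k i * y j ^ ?put \<kappa> k j * R \<kappa>)"
      unfolding e using sp
      by (intro arg_cong2[where f = "(*)"] arg_cong2[where f = "(+)"] sum.cong) auto
  qed
  finally show ?thesis .
qed

lemma sum_pairs_swap:
  "(\<Sum>i=1..N. \<Sum>j\<in>{1..N} - {i}. t j i) = (\<Sum>i=1..N::nat. \<Sum>j\<in>{1..N} - {i}. t i j)"
  unfolding sum.Sigma[OF finite_atLeastAtMost ballI[OF finite_Diff[OF finite_atLeastAtMost]]]
  by (rule sum.reindex_bij_witness[of _ "\<lambda>(a,b). (b,a)" "\<lambda>(a,b). (b,a)"]) auto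

text \<open>A single first-order term has a genuine denominator \<open>y i - y j\<close>. Only the
  combination for \<open>(i, j)\<close> and \<open>(j, i)\<close> is polynomial, and doubling the
  sum over ordered pairs makes exactly these combinations appear.\<close>

lemma laplace_beltrami_mon_sum:
  fixes f :: "(nat \<Rightarrow> nat) \<Rightarrow> complex"
  assumes sym: "\<And>\<sigma> \<gamma>. \<sigma> permutes {1..N} \<Longrightarrow> \<gamma> \<in> Comp N n \<Longrightarrow> f (\<gamma> \<circ> \<sigma>) = f \<gamma>"
    and y: "inj_on y {1..N}"
  shows "laplace_beltrami N \<theta> (\<lambda>y. \<Sum>\<gamma>\<in>Comp N n. f \<gamma> * mon N \<gamma> y) y =
    (\<Sum>\<gamma>\<in>Comp N n. (of_real (lbeig N \<theta> \<gamma>) * f \<gamma> + of_real \<theta> * lbsum N f \<gamma>) * mon N \<gamma> y)"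
proof -
  let ?P = "\<lambda>y. \<Sum>\<gamma>\<in>Comp N n. f \<gamma> * mon N \<gamma> y"
  define D where "D i = (\<Sum>\<gamma>\<in>Comp N n. f \<gamma> * of_nat (\<gamma> i) * mon N \<gamma> y)" for i
  define X where "X i j \<gamma> = of_nat (max (\<gamma> i) (\<gamma> j)) * f \<gamma> +
      (\<Sum>m<min (\<gamma> i) (\<gamma> j). of_nat (\<gamma> i + \<gamma> j - 2 * m) * f (spread \<gamma> i j m))" for i j \<gamma>
  have sq: "(\<Sum>i=1..N. of_nat (\<gamma> i * (\<gamma> i - 1))) = (of_real (real (sumsq N \<gamma>) - real (psize N \<gamma>)) :: complex)" for \<gamma>
  proof -
    have "(of_nat (k * (k - 1)) :: complex) = (of_nat k)\<^sup>2 - of_nat k" for k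
      by (cases k) (auto simp: power2_eq_square algebra_simps)
    then show ?thesis by (simp add: sumsq_def psize_def sum_subtractf)
  qed
  have 1: "(\<Sum>i=1..N. (y i)\<^sup>2 * partial i (partial i ?P) y) =
      (\<Sum>\<gamma>\<in>Comp N n. of_real (real (sumsq N \<gamma>) - real (psize N \<gamma>)) * f \<gamma> * mon N \<gamma> y)"
  proof -
    have "(\<Sum>i=1..N. (y i)\<^sup>2 * partial i (partial i ?P) y) =
       (\<Sum>i=1..N. \<Sum>\<gamma>\<in>Comp N n. of_nat (\<gamma> i * (\<gamma> i - 1)) * (f \<gamma> * mon N \<gamma> y))"
      by (intro sum.cong) (simp_all add: partial2_mon_sum mult_ac)
    also have "\<dots> = (\<Sum>\<gamma>\<in>Comp N n. \<Sum>i=1..N. of_nat (\<gamma> i * (\<gamma> i - 1)) * (f \<gamma> * mon N \<gamma> y))"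
      by (rule sum.swap)
    also have "\<dots> = (\<Sum>\<gamma>\<in>Comp N n. of_real (real (sumsq N \<gamma>) - real (psize N \<gamma>)) * f \<gamma> * mon N \<gamma> y)"
      unfolding sum_distrib_right[symmetric] sq by (simp add: mult_ac)
    finally show ?thesis .
  qed
  let ?t = "\<lambda>i j. (y i)\<^sup>2 / (y i - y j) * partial i ?P y"
  have t: "?t i j + ?t j i = (\<Sum>\<gamma>\<in>Comp N n. X i j \<gamma> * mon N \<gamma> y)"
    if i: "i \<in> {1..N}" and j: "j \<in> {1..N} - {i}" for i j
  proof -
    have ij: "y i - y j \<noteq> 0"
    proof
      assume "y i - y j = 0"
      then have "i = j" using inj_onD[OF y, of i j] i j by simp
      then show False using j by simp
    qed
    have d: "?t k l = y k * D k / (y k - y l)" if "k \<in> {1..N}" for k l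
      using partial1_mon_sum[OF that, where y = y and S = "Comp N n" and c = f]
      by (simp add: D_def power2_eq_square)
    have "?t i j + ?t j i = y i * D i / (y i - y j) + y j * D j / (y j - y i)"
    proof -
      have "j \<in> {1..N}" using j by simp
      then show ?thesis using d[OF i, of j] d[of j i] by (simp only:)
    qed
    also have "\<dots> = (y i * D i - y j * D j) / (y i - y j)"
    proof -
      have "y j * D j / (y j - y i) = - (y j * D j / (y i - y j))"
        by (metis minus_diff_eq minus_divide_right)
      then show ?thesis by (simp add: diff_divide_distrib)
    qed
    also have "y i * D i - y j * D j =
        (\<Sum>\<gamma>\<in>Comp N n. f \<gamma> * (of_nat (\<gamma> i) * y i - of_nat (\<gamma> j) * y j) * mon N \<gamma> y)"
      unfolding D_def sum_distrib_left sum_subtractf[symmetric] by (simp add: algebra_simps)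
    also have "\<dots> = (y i - y j) * (\<Sum>\<gamma>\<in>Comp N n. X i j \<gamma> * mon N \<gamma> y)"
      unfolding X_def using i j by (intro pair_operator sym) auto
    finally show ?thesis using ij by simp
  qed
  have "2 * (\<Sum>i=1..N. \<Sum>j\<in>{1..N} - {i}. ?t i j) =
      (\<Sum>i=1..N. \<Sum>j\<in>{1..N} - {i}. ?t i j) + (\<Sum>i=1..N. \<Sum>j\<in>{1..N} - {i}. ?t j i)"
    by (subst sum_pairs_swap) simp
  also have "\<dots> = (\<Sum>i=1..N. \<Sum>j\<in>{1..N} - {i}. ?t i j + ?t j i)"
    by (simp add: sum.distrib)
  also have "\<dots> = (\<Sum>i=1..N. \<Sum>j\<in>{1..N} - {i}. \<Sum>\<gamma>\<in>Comp N n. X i j \<gamma> * mon N \<gamma> y)"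
    using t by (intro sum.cong) auto
  also have "\<dots> = (\<Sum>i=1..N. \<Sum>\<gamma>\<in>Comp N n. \<Sum>j\<in>{1..N} - {i}. X i j \<gamma> * mon N \<gamma> y)"
    by (intro sum.cong refl sum.swap)
  also have "\<dots> = (\<Sum>\<gamma>\<in>Comp N n. \<Sum>i=1..N. \<Sum>j\<in>{1..N} - {i}. X i j \<gamma> * mon N \<gamma> y)"
    by (rule sum.swap)
  also have "\<dots> = (\<Sum>\<gamma>\<in>Comp N n. (of_nat (summax N \<gamma>) * f \<gamma> + lbsum N f \<gamma>) * mon N \<gamma> y)"
  proof (intro sum.cong refl)
    fix \<gamma>
    have "(\<Sum>i=1..N. \<Sum>j\<in>{1..N} - {i}. X i j \<gamma>) = of_nat (summax N \<gamma>) * f \<gamma> + lbsum N f \<gamma>"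
      unfolding X_def summax_def lbsum_def sum.distrib of_nat_sum sum_distrib_right ..
    then show "(\<Sum>i=1..N. \<Sum>j\<in>{1..N} - {i}. X i j \<gamma> * mon N \<gamma> y) =
        (of_nat (summax N \<gamma>) * f \<gamma> + lbsum N f \<gamma>) * mon N \<gamma> y"
      by (simp only: sum_distrib_right[symmetric])
  qed
  finally have 2: "2 * (\<Sum>i=1..N. \<Sum>j\<in>{1..N} - {i}. ?t i j) = \<dots>" .
  have "laplace_beltrami N \<theta> ?P y =
     (\<Sum>\<gamma>\<in>Comp N n. of_real (real (sumsq N \<gamma>) - real (psize N \<gamma>)) * f \<gamma> * mon N \<gamma> y) +
     of_real \<theta> * (\<Sum>\<gamma>\<in>Comp N n. (of_nat (summax N \<gamma>) * f \<gamma> + lbsum N f \<gamma>) * mon N \<gamma> y)"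
  proof -
    have e: "2 * a * S = a * (2 * S)" for a S :: complex by simp
    show ?thesis unfolding laplace_beltrami_def 1 e 2 ..
  qed
  then show ?thesis
    unfolding sum_distrib_left sum.distrib[symmetric]
    by (simp only: lbeig_def of_real_add of_real_mult of_real_of_nat_eq distrib_right mult.assoc distrib_left add.assoc)
qed

subsection \<open>Jack coefficients\<close>

text \<open>The eigenvalue equation solved for the coefficient at \<open>\<gamma>\<close>. The
  comparison of \<open>sumsq\<close> makes the recursion terminate and, by
  \<open>sub_dom_sumsq_summax\<close>, cuts off no dominated exponent vector outside the orbit of a
  partition \<open>\<mu>\<close>. The sums of \<open>lbsum\<close> are written out so that the
  recursive calls carry the ranges of \<open>i\<close>, \<open>j\<close> and
  \<open>m\<close>.\<close>

function jcoeff :: "nat \<Rightarrow> real \<Rightarrow> (nat \<Rightarrow> nat) \<Rightarrow> (nat \<Rightarrow> nat) \<Rightarrow> real" where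
  "jcoeff N \<theta> \<mu> \<gamma> =
    (if \<gamma> \<in> rearr N \<mu> then 1
     else if sub_dom N \<mu> \<gamma> \<and> sumsq N \<gamma> < sumsq N \<mu> then
       \<theta> * (\<Sum>i=1..N. \<Sum>j\<in>{1..N} - {i}. \<Sum>m<min (\<gamma> i) (\<gamma> j).
         of_nat (\<gamma> i + \<gamma> j - 2 * m) * jcoeff N \<theta> \<mu> (spread \<gamma> i j m)) / (lbeig N \<theta> \<mu> - lbeig N \<theta> \<gamma>)
     else 0)"
  by pat_completeness auto
termination
  by (relation "Wellfounded.measure (\<lambda>(N, \<theta>, \<mu>, \<gamma>). sumsq N \<mu> - sumsq N \<gamma>)")
     (auto intro!: diff_less_mono2 sumsq_spread_less)

declare jcoeff.simps [simp del]

lemma jcoeff_unfold: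
  "jcoeff N \<theta> \<mu> \<gamma> =
    (if \<gamma> \<in> rearr N \<mu> then 1
     else if sub_dom N \<mu> \<gamma> \<and> sumsq N \<gamma> < sumsq N \<mu> then
       \<theta> * lbsum N (jcoeff N \<theta> \<mu>) \<gamma> / (lbeig N \<theta> \<mu> - lbeig N \<theta> \<gamma>)
     else 0)"
  by (subst jcoeff.simps) (simp only: lbsum_def)

lemma lbsum_zero:
  assumes "\<And>i j m. i \<in> {1..N} \<Longrightarrow> j \<in> {1..N} \<Longrightarrow> i \<noteq> j \<Longrightarrow> m < min (\<gamma> i) (\<gamma> j)
      \<Longrightarrow> f (spread \<gamma> i j m) = 0"
  shows "lbsum N f \<gamma> = 0"
  unfolding lbsum_def by (intro sum.neutral ballI) (auto simp: assms)

lemma lbsum_cong: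
  assumes "\<And>i j m. i \<in> {1..N} \<Longrightarrow> j \<in> {1..N} \<Longrightarrow> i \<noteq> j \<Longrightarrow> m < min (\<gamma> i) (\<gamma> j)
      \<Longrightarrow> f (spread \<gamma> i j m) = g (spread \<gamma> i j m)"
  shows "lbsum N f \<gamma> = lbsum N g \<gamma>"
  unfolding lbsum_def by (intro sum.cong) (auto simp: assms)

lemma lbsum_of_real: "lbsum N (\<lambda>\<gamma>. complex_of_real (f \<gamma>)) \<gamma> = of_real (lbsum N f \<gamma>)"
  unfolding lbsum_def by simp

lemma lbeig_permutes: "\<sigma> permutes {1..N} \<Longrightarrow> lbeig N \<theta> (\<gamma> \<circ> \<sigma>) = lbeig N \<theta> \<gamma>"
  unfolding lbeig_def by (simp add: sumsq_permutes summax_permutes psize_permutes)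

lemma lbeig_rearr: "\<gamma> \<in> rearr N \<mu> \<Longrightarrow> lbeig N \<theta> \<gamma> = lbeig N \<theta> \<mu>"
  using lbeig_permutes by (auto simp: rearr_def)

lemma sumsq_rearr: "\<gamma> \<in> rearr N \<mu> \<Longrightarrow> sumsq N \<gamma> = sumsq N \<mu>"
  using sumsq_permutes by (auto simp: rearr_def)

text \<open>The size terms cancel and the \<open>summax\<close> terms have the favourable sign, so
  the denominators of the recursion are bounded below independently of
  \<open>\<theta>\<close>.\<close>

lemma lbeig_gap:
  assumes "\<mu> \<in> Par N" "sub_dom N \<mu> \<gamma>" "\<gamma> \<in> Comp N (psize N \<mu>)" "\<theta> > 0"
  shows "real (sumsq N \<mu>) - real (sumsq N \<gamma>) \<le> lbeig N \<theta> \<mu> - lbeig N \<theta> \<gamma>"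
proof -
  have "\<theta> * real (summax N \<gamma>) \<le> \<theta> * real (summax N \<mu>)"
    using sub_dom_sumsq_summax(1)[OF assms(1,2,3)] assms(4) by simp
  then show ?thesis using assms(3) by (simp add: lbeig_def Comp_def)
qed

lemma jcoeff_rearr: "\<gamma> \<in> rearr N \<mu> \<Longrightarrow> jcoeff N \<theta> \<mu> \<gamma> = 1"
  by (subst jcoeff_unfold) simp

lemma jcoeff_not_dom: "\<mu> \<in> Par N \<Longrightarrow> \<not> sub_dom N \<mu> \<gamma> \<Longrightarrow> jcoeff N \<theta> \<mu> \<gamma> = 0"
  by (subst jcoeff_unfold) (auto dest: sub_dom_rearr)

text \<open>Spreading increases \<open>sumsq\<close>, which is already maximal at \<open>\<mu>\<close>.\<close>

lemma spread_rearr_not_dom: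
  assumes \<mu>: "\<mu> \<in> Par N" and \<gamma>: "\<gamma> \<in> rearr N \<mu>"
    and s: "i \<in> {1..N}" "j \<in> {1..N}" "i \<noteq> j" "m < min (\<gamma> i) (\<gamma> j)"
  shows "\<not> sub_dom N \<mu> (spread \<gamma> i j m)"
proof
  assume d: "sub_dom N \<mu> (spread \<gamma> i j m)"
  have "spread \<gamma> i j m \<in> Comp N (psize N \<mu>)"
    using rearr_Comp[OF \<gamma> Par_subset_Comp[OF \<mu>]] s by (intro spread_Comp)
  from sub_dom_sumsq_summax(2)[OF \<mu> d this] sumsq_spread_less[OF s] sumsq_rearr[OF \<gamma>]
  show False by simp
qed

text \<open>Off the orbit and within the dominated region this is the recursion. On the orbit, and
  outside the dominated region, every spread vector fails to be dominated, so the right-hand side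
  vanishes; the left-hand side does too, by equal eigenvalues or by a zero coefficient.\<close>

lemma jcoeff_eigen:
  assumes \<mu>: "\<mu> \<in> Par N" and \<theta>: "\<theta> > 0" and \<gamma>: "\<gamma> \<in> Comp N (psize N \<mu>)"
  shows "(lbeig N \<theta> \<mu> - lbeig N \<theta> \<gamma>) * jcoeff N \<theta> \<mu> \<gamma> = \<theta> * lbsum N (jcoeff N \<theta> \<mu>) \<gamma>"
proof -
  consider "\<gamma> \<in> rearr N \<mu>" | "\<not> sub_dom N \<mu> \<gamma>" | "\<gamma> \<notin> rearr N \<mu>" "sub_dom N \<mu> \<gamma>" by blast
  then show ?thesis
  proof cases
    case 1
    then have "lbsum N (jcoeff N \<theta> \<mu>) \<gamma> = 0"
      by (intro lbsum_zero jcoeff_not_dom spread_rearr_not_dom \<mu>)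
    then show ?thesis using lbeig_rearr[OF 1] by simp
  next
    case 2
    then have "lbsum N (jcoeff N \<theta> \<mu>) \<gamma> = 0"
      using sub_dom_spread by (intro lbsum_zero jcoeff_not_dom \<mu>) blast
    then show ?thesis using jcoeff_not_dom[OF \<mu> 2] by simp
  next
    case 3
    have lt: "sumsq N \<gamma> < sumsq N \<mu>" using sub_dom_sumsq_summax(3)[OF \<mu> 3(2) \<gamma> 3(1)] .
    then have "lbeig N \<theta> \<mu> - lbeig N \<theta> \<gamma> \<noteq> 0" using lbeig_gap[OF \<mu> 3(2) \<gamma> \<theta>] by linarith
    then show ?thesis using 3 lt by (subst jcoeff_unfold) simp
  qed
qed

text \<open>Well-founded because \<open>sumsq\<close> strictly increases under \<open>spread\<close>
  and is at most \<open>N * n\<^sup>2\<close> on \<open>Comp N n\<close>.\<close>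

lemma spread_induct [consumes 1, case_names less]:
  assumes "\<gamma> \<in> Comp N n"
    and "\<And>\<gamma>. \<gamma> \<in> Comp N n \<Longrightarrow>
      (\<And>i j m. i \<in> {1..N} \<Longrightarrow> j \<in> {1..N} \<Longrightarrow> i \<noteq> j \<Longrightarrow> m < min (\<gamma> i) (\<gamma> j) \<Longrightarrow> P (spread \<gamma> i j m))
      \<Longrightarrow> P \<gamma>"
  shows "P \<gamma>"
proof -
  have le: "sumsq N \<gamma> \<le> N * n\<^sup>2" if "\<gamma> \<in> Comp N n" for \<gamma>
    using sum_bounded_above[of "{1..N}" "\<lambda>i. (\<gamma> i)\<^sup>2" "n\<^sup>2"] Comp_le[OF that]
    by (simp add: sumsq_def power_mono)
  show ?thesis using assms(1)
  proof (induction "N * n\<^sup>2 - sumsq N \<gamma>" arbitrary: \<gamma> rule: less_induct)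
    case less
    show ?case
    proof (rule assms(2)[OF less.prems])
      fix i j m assume s: "i \<in> {1..N}" "j \<in> {1..N}" "i \<noteq> j" "m < min (\<gamma> i) (\<gamma> j)"
      have c: "spread \<gamma> i j m \<in> Comp N n" using spread_Comp[OF less.prems s] .
      show "P (spread \<gamma> i j m)"
        using sumsq_spread_less[OF s] le[OF c] by (intro less.hyps c) linarith
    qed
  qed
qed

text \<open>Invariance of \<open>f\<close> is asked for only at the vectors spread from
  \<open>\<gamma>\<close>, which is what the hypothesis of \<open>spread_induct\<close>
  supplies.\<close>

lemma lbsum_permutes:
  assumes \<sigma>: "\<sigma> permutes {1..N}"
    and f: "\<And>i j m. i \<in> {1..N} \<Longrightarrow> j \<in> {1..N} \<Longrightarrow> i \<noteq> j \<Longrightarrow> m < min (\<gamma> i) (\<gamma> j)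
      \<Longrightarrow> f (spread \<gamma> i j m \<circ> \<sigma>) = f (spread \<gamma> i j m)"
  shows "lbsum N f (\<gamma> \<circ> \<sigma>) = lbsum N f \<gamma>"
proof -
  have inj: "inj \<sigma>" using permutes_inj[OF \<sigma>] .
  define G where "G i j = (\<Sum>m<min (\<gamma> i) (\<gamma> j). of_nat (\<gamma> i + \<gamma> j - 2 * m) * f (spread \<gamma> i j m))" for i j
  have "lbsum N f (\<gamma> \<circ> \<sigma>) = (\<Sum>i=1..N. \<Sum>j\<in>{1..N} - {i}. G (\<sigma> i) (\<sigma> j))"
    unfolding lbsum_def G_def
  proof (intro sum.cong refl)
    fix i j m assume h: "i \<in> {1..N}" "j \<in> {1..N} - {i}" "m \<in> {..<min (\<gamma> (\<sigma> i)) (\<gamma> (\<sigma> j))}"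
    have "\<sigma> i \<in> {1..N}" "\<sigma> j \<in> {1..N}" "\<sigma> i \<noteq> \<sigma> j"
      using h permutes_in_image[OF \<sigma>] inj by (auto simp: inj_eq)
    then have "f (spread (\<gamma> \<circ> \<sigma>) i j m) = f (spread \<gamma> (\<sigma> i) (\<sigma> j) m)"
      unfolding spread_permutes[OF inj] using h by (intro f) auto
    then show "of_nat ((\<gamma> \<circ> \<sigma>) i + (\<gamma> \<circ> \<sigma>) j - 2 * m) * f (spread (\<gamma> \<circ> \<sigma>) i j m) =
       of_nat (\<gamma> (\<sigma> i) + \<gamma> (\<sigma> j) - 2 * m) * f (spread \<gamma> (\<sigma> i) (\<sigma> j) m)" by simp
  qed auto
  also have "\<dots> = lbsum N f \<gamma>"
    unfolding sum_pairs_permutes[OF \<sigma>] by (simp add: lbsum_def G_def)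
  finally show ?thesis .
qed

lemma jcoeff_permutes:
  assumes \<mu>: "\<mu> \<in> Par N" and \<theta>: "\<theta> > 0" and \<sigma>: "\<sigma> permutes {1..N}"
    and \<gamma>: "\<gamma> \<in> Comp N (psize N \<mu>)"
  shows "jcoeff N \<theta> \<mu> (\<gamma> \<circ> \<sigma>) = jcoeff N \<theta> \<mu> \<gamma>"
  using \<gamma>
proof (induction rule: spread_induct)
  case (less \<gamma>)
  then have "lbsum N (jcoeff N \<theta> \<mu>) (\<gamma> \<circ> \<sigma>) = lbsum N (jcoeff N \<theta> \<mu>) \<gamma>"
    by (intro lbsum_permutes \<sigma>) blast
  then show ?case
    by (subst (1 2) jcoeff_unfold)
      (simp add: rearr_permutes_iff[OF \<sigma>] sub_dom_permutes_iff[OF \<sigma>]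
        sumsq_permutes[OF \<sigma>] lbeig_permutes[OF \<sigma>] del: o_apply)
qed

lemma jcoeff_nonneg:
  assumes \<mu>: "\<mu> \<in> Par N" and \<theta>: "\<theta> > 0" and \<gamma>: "\<gamma> \<in> Comp N (psize N \<mu>)"
  shows "jcoeff N \<theta> \<mu> \<gamma> \<ge> 0"
  using \<gamma>
proof (induction rule: spread_induct)
  case (less \<gamma>)
  then have s: "lbsum N (jcoeff N \<theta> \<mu>) \<gamma> \<ge> 0"
    unfolding lbsum_def by (intro sum_nonneg mult_nonneg_nonneg) auto
  show ?case
  proof (cases "\<gamma> \<notin> rearr N \<mu> \<and> sub_dom N \<mu> \<gamma> \<and> sumsq N \<gamma> < sumsq N \<mu>")
    case True
    then have "lbeig N \<theta> \<mu> - lbeig N \<theta> \<gamma> \<ge> 0" using lbeig_gap[OF \<mu> _ less(1) \<theta>] by auto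
    then show ?thesis using True s \<theta>
      by (subst jcoeff_unfold) simp
  qed (subst jcoeff_unfold, auto)
qed

text \<open>The equation at \<open>\<mu>\<close> has no off-diagonal terms, so it forces
  \<open>c\<close> to be the eigenvalue of \<open>\<mu>\<close>. Elsewhere in the dominated region
  the eigenvalue gap is nonzero, and the equation determines \<open>f \<gamma>\<close> from its
  values at spread vectors.\<close>

lemma eigen_coeff_unique:
  fixes f :: "(nat \<Rightarrow> nat) \<Rightarrow> complex"
  assumes \<mu>: "\<mu> \<in> Par N" and \<theta>: "\<theta> > 0"
    and sym: "\<And>\<sigma> \<gamma>. \<sigma> permutes {1..N} \<Longrightarrow> \<gamma> \<in> Comp N (psize N \<mu>) \<Longrightarrow> f (\<gamma> \<circ> \<sigma>) = f \<gamma>"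
    and f\<mu>: "f \<mu> = 1" and dom: "\<And>\<gamma>. \<gamma> \<in> Comp N (psize N \<mu>) \<Longrightarrow> \<not> sub_dom N \<mu> \<gamma> \<Longrightarrow> f \<gamma> = 0"
    and eig: "\<And>\<gamma>. \<gamma> \<in> Comp N (psize N \<mu>) \<Longrightarrow>
      of_real (lbeig N \<theta> \<gamma>) * f \<gamma> + of_real \<theta> * lbsum N f \<gamma> = c * f \<gamma>"
    and \<gamma>: "\<gamma> \<in> Comp N (psize N \<mu>)"
  shows "f \<gamma> = of_real (jcoeff N \<theta> \<mu> \<gamma>)"
proof -
  have \<mu>C: "\<mu> \<in> Comp N (psize N \<mu>)" using Par_subset_Comp[OF \<mu>] .
  have "lbsum N f \<mu> = 0"
    using \<mu> \<mu>C by (intro lbsum_zero dom spread_Comp spread_rearr_not_dom) auto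
  then have c: "c = of_real (lbeig N \<theta> \<mu>)" using eig[OF \<mu>C] f\<mu> by simp
  show ?thesis using \<gamma>
  proof (induction rule: spread_induct)
    case (less \<gamma>)
    consider "\<gamma> \<in> rearr N \<mu>" | "\<not> sub_dom N \<mu> \<gamma>" | "\<gamma> \<notin> rearr N \<mu>" "sub_dom N \<mu> \<gamma>" by blast
    then show ?case
    proof cases
      case 1
      then have "f \<gamma> = 1" using sym \<mu>C f\<mu> by (auto simp: rearr_def)
      then show ?thesis using jcoeff_rearr[OF 1] by simp
    next
      case 2
      then show ?thesis using dom less(1) jcoeff_not_dom[OF \<mu>] by simp
    next
      case 3
      have "sumsq N \<gamma> < sumsq N \<mu>" using sub_dom_sumsq_summax(3)[OF \<mu> 3(2) less(1) 3(1)] .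
      then have nz: "lbeig N \<theta> \<mu> - lbeig N \<theta> \<gamma> \<noteq> 0" using lbeig_gap[OF \<mu> 3(2) less(1) \<theta>] by linarith
      have "lbsum N f \<gamma> = lbsum N (\<lambda>\<gamma>. of_real (jcoeff N \<theta> \<mu> \<gamma>)) \<gamma>"
        using less(2) by (intro lbsum_cong)
      then have "of_real (lbeig N \<theta> \<mu> - lbeig N \<theta> \<gamma>) * f \<gamma> = of_real (\<theta> * lbsum N (jcoeff N \<theta> \<mu>) \<gamma>)"
        using eig[OF less(1)] by (simp add: c lbsum_of_real algebra_simps)
      also have "\<dots> = of_real (lbeig N \<theta> \<mu> - lbeig N \<theta> \<gamma>) * complex_of_real (jcoeff N \<theta> \<mu> \<gamma>)"
        unfolding jcoeff_eigen[OF \<mu> \<theta> less(1), symmetric] by simp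
      finally show ?thesis using nz by (metis mult_left_cancel of_real_eq_0_iff)
    qed
  qed
qed

section \<open>Identification of \<open>jack\<close>\<close>

lemma sum_Comp_Par:
  "(\<Sum>\<gamma>\<in>Comp N n. h \<gamma>) = (\<Sum>\<nu>\<in>{\<nu> \<in> Par N. psize N \<nu> = n}. \<Sum>\<gamma>\<in>rearr N \<nu>. h \<gamma>)"
proof -
  have "Comp N n = (\<Union>\<nu>\<in>{\<nu> \<in> Par N. psize N \<nu> = n}. rearr N \<nu>)"
    using ex_Par_rearr[of _ N n] rearr_Comp Par_subset_Comp by blast
  moreover have "finite {\<nu> \<in> Par N. psize N \<nu> = n}"
    by (rule finite_subset[OF _ finite_Comp[of N n]]) (auto dest: Par_subset_Comp)
  moreover have "rearr N \<nu> \<inter> rearr N \<nu>' = {}" if "\<nu> \<in> Par N" "\<nu>' \<in> Par N" "\<nu> \<noteq> \<nu>'" for \<nu> \<nu>'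
    using that rearr_Par_unique rearr_sym rearr_trans by blast
  ultimately show ?thesis by (simp add: sum.UNION_disjoint)
qed

lemma monom_sym_eq: "monom_sym N \<nu> y = (\<Sum>\<gamma>\<in>rearr N \<nu>. mon N \<gamma> y)"
  by (simp add: monom_sym_def rearr_def mon_def)

lemma sum_mon_eq_sum_monom_sym:
  fixes f :: "(nat \<Rightarrow> nat) \<Rightarrow> complex"
  assumes sym: "\<And>\<nu> \<gamma>. \<nu> \<in> Par N \<Longrightarrow> psize N \<nu> = psize N \<mu> \<Longrightarrow> \<gamma> \<in> rearr N \<nu> \<Longrightarrow> f \<gamma> = g \<nu>"
    and dom: "\<And>\<nu>. \<nu> \<in> Par N \<Longrightarrow> psize N \<nu> = psize N \<mu> \<Longrightarrow> \<not> sub_dom N \<mu> \<nu> \<Longrightarrow> g \<nu> = 0"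
  shows "(\<Sum>\<gamma>\<in>Comp N (psize N \<mu>). f \<gamma> * mon N \<gamma> y) =
    (\<Sum>\<nu>\<in>{\<nu> \<in> Par N. dominates N \<mu> \<nu>}. g \<nu> * monom_sym N \<nu> y)"
proof -
  have fin: "finite {\<nu> \<in> Par N. psize N \<nu> = psize N \<mu>}"
    by (rule finite_subset[OF _ finite_Comp[of N "psize N \<mu>"]]) (auto dest: Par_subset_Comp)
  have "(\<Sum>\<gamma>\<in>Comp N (psize N \<mu>). f \<gamma> * mon N \<gamma> y) =
     (\<Sum>\<nu>\<in>{\<nu> \<in> Par N. psize N \<nu> = psize N \<mu>}. g \<nu> * monom_sym N \<nu> y)"
    unfolding sum_Comp_Par monom_sym_eq sum_distrib_left by (intro sum.cong) (auto simp: sym)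
  also have "\<dots> = (\<Sum>\<nu>\<in>{\<nu> \<in> Par N. dominates N \<mu> \<nu>}. g \<nu> * monom_sym N \<nu> y)"
    using fin by (intro sum.mono_neutral_right) (auto simp: dominates_iff_sub_dom dom, auto simp: sub_dom_def)
  finally show ?thesis .
qed

lemma jack_eq:
  assumes \<mu>: "\<mu> \<in> Par N" and \<theta>: "\<theta> > 0"
  shows "jack N \<theta> \<mu> = (\<lambda>y. \<Sum>\<gamma>\<in>Comp N (psize N \<mu>). of_real (jcoeff N \<theta> \<mu> \<gamma>) * mon N \<gamma> y)"
    (is "_ = ?P")
  unfolding jack_def
proof (rule the_equality)
  let ?n = "psize N \<mu>"
  have \<mu>C: "\<mu> \<in> Comp N ?n" using Par_subset_Comp[OF \<mu>] .
  let ?f = "\<lambda>\<gamma>. complex_of_real (jcoeff N \<theta> \<mu> \<gamma>)"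
  have rep: "?P = (\<lambda>y. \<Sum>\<nu>\<in>{\<nu> \<in> Par N. dominates N \<mu> \<nu>}. ?f \<nu> * monom_sym N \<nu> y)"
  proof (intro ext sum_mon_eq_sum_monom_sym)
    fix \<nu> \<gamma> assume h: "\<nu> \<in> Par N" "psize N \<nu> = ?n" "\<gamma> \<in> rearr N \<nu>"
    then show "?f \<gamma> = ?f \<nu>" using jcoeff_permutes[OF \<mu> \<theta> _ , of _ \<nu>] Par_subset_Comp[of \<nu> N]
      by (auto simp: rearr_def)
  qed (simp add: jcoeff_not_dom[OF \<mu>])
  have "laplace_beltrami N \<theta> ?P y = of_real (lbeig N \<theta> \<mu>) * ?P y" if "inj_on y {1..N}" for y
  proof -
    have "laplace_beltrami N \<theta> ?P y =
       (\<Sum>\<gamma>\<in>Comp N ?n. (of_real (lbeig N \<theta> \<gamma>) * ?f \<gamma> + of_real \<theta> * lbsum N ?f \<gamma>) * mon N \<gamma> y)"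
      using that jcoeff_permutes[OF \<mu> \<theta>] by (intro laplace_beltrami_mon_sum) auto
    also have "\<dots> = (\<Sum>\<gamma>\<in>Comp N ?n. of_real (lbeig N \<theta> \<mu>) * (?f \<gamma> * mon N \<gamma> y))"
    proof (rule sum.cong)
      fix \<gamma> assume "\<gamma> \<in> Comp N ?n"
      from jcoeff_eigen[OF \<mu> \<theta> this]
      have "lbeig N \<theta> \<gamma> * jcoeff N \<theta> \<mu> \<gamma> + \<theta> * lbsum N (jcoeff N \<theta> \<mu>) \<gamma> = lbeig N \<theta> \<mu> * jcoeff N \<theta> \<mu> \<gamma>"
        by (simp add: algebra_simps)
      then have "of_real (lbeig N \<theta> \<gamma>) * ?f \<gamma> + of_real \<theta> * lbsum N ?f \<gamma> = of_real (lbeig N \<theta> \<mu>) * ?f \<gamma>"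
        unfolding lbsum_of_real by (metis of_real_add of_real_mult)
      then show "(of_real (lbeig N \<theta> \<gamma>) * ?f \<gamma> + of_real \<theta> * lbsum N ?f \<gamma>) * mon N \<gamma> y =
          of_real (lbeig N \<theta> \<mu>) * (?f \<gamma> * mon N \<gamma> y)" by (simp add: mult.assoc)
    qed simp
    finally show ?thesis by (simp add: sum_distrib_left)
  qed
  then show "is_jack N \<theta> \<mu> ?P"
    unfolding is_jack_def using rep jcoeff_rearr[OF rearr_refl, of N \<theta> \<mu>]
    by (intro conjI exI[of _ ?f] exI[of _ "of_real (lbeig N \<theta> \<mu>)"]) auto
  fix P assume "is_jack N \<theta> \<mu> P"
  then obtain u c where u: "u \<mu> = 1"
      "P = (\<lambda>y. \<Sum>\<nu>\<in>{\<nu> \<in> Par N. dominates N \<mu> \<nu>}. u \<nu> * monom_sym N \<nu> y)"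
    and c: "\<And>y. inj_on y {1..N} \<Longrightarrow> laplace_beltrami N \<theta> P y = c * P y"
    unfolding is_jack_def by blast
  \<comment> \<open>The given coefficients \<open>u\<close> are meaningful only at partitions
    dominated by \<open>\<mu>\<close>. They are extended to exponent vectors by sorting, and by
    \<open>0\<close> outside the dominated region, where \<open>u\<close> is arbitrary.\<close>
  define srt where "srt \<gamma> = (THE \<nu>. \<nu> \<in> Par N \<and> \<gamma> \<in> rearr N \<nu>)" for \<gamma>
  have srt: "srt \<gamma> = \<nu>" if "\<nu> \<in> Par N" "\<gamma> \<in> rearr N \<nu>" for \<gamma> \<nu>
    unfolding srt_def using that rearr_Par_unique rearr_trans rearr_sym by (intro the_equality) blast+
  define f where "f \<gamma> = (if sub_dom N \<mu> \<gamma> then u (srt \<gamma>) else 0)" for \<gamma>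
  have srt_perm: "srt (\<gamma> \<circ> \<sigma>) = srt \<gamma>" if "\<sigma> permutes {1..N}" for \<gamma> \<sigma>
    unfolding srt_def rearr_permutes_iff[OF that] ..
  have sym: "f (\<gamma> \<circ> \<sigma>) = f \<gamma>" if "\<sigma> permutes {1..N}" for \<gamma> \<sigma>
    unfolding f_def sub_dom_permutes_iff[OF that] srt_perm[OF that] ..
  have P: "P = (\<lambda>y. \<Sum>\<gamma>\<in>Comp N ?n. f \<gamma> * mon N \<gamma> y)"
    unfolding u(2)
  proof (rule ext)
    fix y
    have "(\<Sum>\<gamma>\<in>Comp N ?n. f \<gamma> * mon N \<gamma> y) =
      (\<Sum>\<nu>\<in>{\<nu> \<in> Par N. dominates N \<mu> \<nu>}. f \<nu> * monom_sym N \<nu> y)"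
    proof (rule sum_mon_eq_sum_monom_sym)
      fix \<nu> \<gamma> assume "\<gamma> \<in> rearr N \<nu>"
      then show "f \<gamma> = f \<nu>" using sym by (auto simp: rearr_def)
    qed (simp add: f_def)
    also have "\<dots> = (\<Sum>\<nu>\<in>{\<nu> \<in> Par N. dominates N \<mu> \<nu>}. u \<nu> * monom_sym N \<nu> y)"
      by (intro sum.cong) (auto simp: f_def dominates_iff_sub_dom srt)
    finally show "(\<Sum>\<nu>\<in>{\<nu> \<in> Par N. dominates N \<mu> \<nu>}. u \<nu> * monom_sym N \<nu> y) =
       (\<Sum>\<gamma>\<in>Comp N ?n. f \<gamma> * mon N \<gamma> y)" ..
  qed
  have "of_real (lbeig N \<theta> \<gamma>) * f \<gamma> + of_real \<theta> * lbsum N f \<gamma> = c * f \<gamma>" if \<gamma>: "\<gamma> \<in> Comp N ?n" for \<gamma>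
  proof -
    \<comment> \<open>The eigenvalue equation is known only at points with distinct coordinates;
      \<open>mon_lin_indep\<close> turns it into an equation for each coefficient.\<close>
    let ?d = "\<lambda>\<gamma>. of_real (lbeig N \<theta> \<gamma>) * f \<gamma> + of_real \<theta> * lbsum N f \<gamma> - c * f \<gamma>"
    have "(\<Sum>\<gamma>\<in>Comp N ?n. ?d \<gamma> * mon N \<gamma> y) = 0" if y: "inj_on y {1..N}" for y
    proof -
      have "(\<Sum>\<gamma>\<in>Comp N ?n. (of_real (lbeig N \<theta> \<gamma>) * f \<gamma> + of_real \<theta> * lbsum N f \<gamma>) * mon N \<gamma> y) = c * P y"
        using c[OF y] laplace_beltrami_mon_sum[where f = f and n = ?n and y = y and \<theta> = \<theta>] sym y unfolding P by simp
      then show ?thesis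
        by (simp add: P left_diff_distrib sum_subtractf sum_distrib_left mult.assoc)
    qed
    from mon_lin_indep[where d = ?d, OF this \<gamma>] show ?thesis by simp
  qed
  moreover have "f \<mu> = 1" by (simp add: f_def u(1) srt[OF \<mu> rearr_refl] sub_dom_refl[OF \<mu>])
  moreover have "f \<gamma> = 0" if "\<not> sub_dom N \<mu> \<gamma>" for \<gamma> using that by (simp add: f_def)
  ultimately have "f \<gamma> = ?f \<gamma>" if "\<gamma> \<in> Comp N ?n" for \<gamma>
    using \<mu> \<theta> sym that by (intro eigen_coeff_unique[where c = c]) (auto simp del: o_apply)
  then show "P = ?P" unfolding P by (intro ext sum.cong) auto
qed

subsection \<open>Bounds and limits of Jack polynomials and hook products\<close>

text \<open>An algebraic form of the estimate that the integral of \<open>(p + 1) * t ^ p\<close>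
  from \<open>y\<close> to \<open>x\<close> is at least its lower endpoint value times the
  length.\<close>

lemma mult_power_diff_le:
  fixes x y :: real
  assumes "0 \<le> y" "y \<le> x"
  shows "real (Suc p) * y ^ p * (x - y) \<le> x ^ Suc p - y ^ Suc p"
proof (induction p)
  case (Suc p)
  have "y * (real (Suc p) * y ^ p * (x - y)) \<le> x * (x ^ Suc p - y ^ Suc p)"
    using assms Suc by (intro mult_mono) (auto simp: power_mono simp del: power_Suc of_nat_Suc)
  then show ?case by (simp add: algebra_simps)
qed simp

text \<open>
  Makes \<open>(1 + sumsq \<mu> - sumsq \<gamma>) ^ p\<close> a supersolution of the recursion: spreading increases \<open>sumsq\<close> by
  \<open>2 (a - m) (b - m)\<close>, whose differences in \<open>m\<close> dominate the weights \<open>a + b - 2 m\<close>, so the sum is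
  bounded by a telescoping one.
\<close>

lemma spread_sum_bound:
  fixes g :: "nat \<Rightarrow> real" and B :: real and a b p :: nat
  assumes B: "B \<ge> 0"
    and g: "\<And>m. m < min a b \<Longrightarrow> g m \<noteq> 0 \<Longrightarrow>
      B - 2 * (real a - real m) * (real b - real m) \<ge> 0 \<and>
      g m \<le> (B - 2 * (real a - real m) * (real b - real m)) ^ p"
  shows "(\<Sum>m<min a b. of_nat (a + b - 2 * m) * g m) \<le> B ^ Suc p / real (Suc p)"
proof -
  define D where "D m = 2 * (real a - real m) * (real b - real m)" for m :: nat
  \<comment> \<open>Truncation at \<open>0\<close> keeps the telescoping sequence nonnegative and
    increasing also where \<open>B - D m\<close> is negative; there \<open>g m\<close> vanishes by
    hypothesis.\<close>
  define X where "X m = max 0 (B - D m)" for m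
  have step: "of_nat (a + b - 2 * m) * g m \<le> (X (Suc m) ^ Suc p - X m ^ Suc p) / real (Suc p)"
    if m: "m < min a b" for m
  proof -
    have ab: "real a - real m \<ge> 1" "real b - real m \<ge> 1" using m by linarith+
    have dd: "D m - D (Suc m) = 2 * ((real a - real m) + (real b - real m) - 1)"
      by (simp add: D_def algebra_simps)
    have co: "real (a + b - 2 * m) = (real a - real m) + (real b - real m)"
      using m by (simp add: of_nat_diff)
    have mono: "0 \<le> X m" "X m \<le> X (Suc m)"
      using dd ab by (auto simp: X_def max_def)
    show ?thesis
    proof (cases "g m = 0")
      case True
      then show ?thesis using mono by (simp add: power_mono del: power_Suc of_nat_Suc)
    next
      case False
      then have Xm: "X m = B - D m" "g m \<le> X m ^ p" using g[OF m] by (auto simp: X_def D_def)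
      have "real (a + b - 2 * m) \<le> X (Suc m) - X m"
        using Xm(1) dd ab co by (auto simp: X_def max_def)
      then have "real (a + b - 2 * m) * g m \<le> (X (Suc m) - X m) * X m ^ p"
        using Xm(2) mono by (intro order.trans[OF mult_left_mono mult_right_mono]) auto
      also have "\<dots> = (real (Suc p) * X m ^ p * (X (Suc m) - X m)) / real (Suc p)"
        by (simp add: field_simps)
      also have "\<dots> \<le> (X (Suc m) ^ Suc p - X m ^ Suc p) / real (Suc p)"
        using mult_power_diff_le[OF mono, of p] by (intro divide_right_mono) auto
      finally show ?thesis by simp
    qed
  qed
  have "(\<Sum>m<min a b. of_nat (a + b - 2 * m) * g m) \<le>
      (\<Sum>m<min a b. (X (Suc m) ^ Suc p - X m ^ Suc p) / real (Suc p))"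
    using step by (intro sum_mono) auto
  also have "\<dots> = (X (min a b) ^ Suc p - X 0 ^ Suc p) / real (Suc p)"
    unfolding sum_divide_distrib[symmetric]
    using sum_lessThan_telescope[of "\<lambda>m. X m ^ Suc p" "min a b"] by simp
  also have "\<dots> \<le> B ^ Suc p / real (Suc p)"
  proof -
    \<comment> \<open>One factor of \<open>D\<close> vanishes at \<open>m = min a b\<close>.\<close>
    have "X (min a b) = B" using B by (auto simp: X_def D_def min_def)
    moreover have "X 0 \<ge> 0" by (simp add: X_def)
    ultimately show ?thesis by (intro divide_right_mono) auto
  qed
  finally show ?thesis .
qed

text \<open>The induction hypothesis is used with the factor \<open>\<theta>\<close> weakened to
  \<open>1\<close>; the recursion supplies a fresh \<open>\<theta>\<close> off the orbit. This
  remaining factor is what later forces those coefficients to \<open>0\<close> in the limit.\<close>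

lemma jcoeff_dom_bound:
  assumes \<mu>: "\<mu> \<in> Par N" and \<theta>: "0 < \<theta>" "\<theta> \<le> 1"
    and \<gamma>: "\<gamma> \<in> Comp N (psize N \<mu>)" and dom: "sub_dom N \<mu> \<gamma>"
  shows "jcoeff N \<theta> \<mu> \<gamma> \<le> (if \<gamma> \<in> rearr N \<mu> then 1 else \<theta>) *
    (1 + real (sumsq N \<mu>) - real (sumsq N \<gamma>)) ^ (2 * N\<^sup>2)"
  using \<gamma> dom
proof (induction rule: spread_induct)
  case (less \<gamma>)
  let ?A = "real (sumsq N \<mu>) - real (sumsq N \<gamma>)" and ?p = "2 * N\<^sup>2"
  show ?case
  proof (cases "\<gamma> \<in> rearr N \<mu>")
    case True
    then show ?thesis using sumsq_rearr[OF True] jcoeff_rearr[OF True] by simp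
  next
    case False
    have "sumsq N \<gamma> < sumsq N \<mu>" using sub_dom_sumsq_summax(3)[OF \<mu> less(3,1) False] .
    then have A: "?A \<ge> 1" by linarith
    have inner: "(\<Sum>m<min (\<gamma> i) (\<gamma> j). of_nat (\<gamma> i + \<gamma> j - 2 * m) * jcoeff N \<theta> \<mu> (spread \<gamma> i j m))
        \<le> (1 + ?A) ^ Suc ?p / real (Suc ?p)" if i: "i \<in> {1..N}" and j: "j \<in> {1..N} - {i}" for i j
    proof (rule spread_sum_bound)
      fix m assume m: "m < min (\<gamma> i) (\<gamma> j)" and nz: "jcoeff N \<theta> \<mu> (spread \<gamma> i j m) \<noteq> 0"
      have h: "i \<in> {1..N}" "j \<in> {1..N}" "i \<noteq> j" using i j by auto
      let ?l = "spread \<gamma> i j m"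
      have d: "sub_dom N \<mu> ?l" using nz jcoeff_not_dom[OF \<mu>] by blast
      have c: "?l \<in> Comp N (psize N \<mu>)" using spread_Comp[OF less(1) h m] .
      have le: "sumsq N ?l \<le> sumsq N \<mu>" using sub_dom_sumsq_summax(2)[OF \<mu> d c] .
      have e: "1 + real (sumsq N \<mu>) - real (sumsq N ?l) =
          1 + ?A - 2 * (real (\<gamma> i) - real m) * (real (\<gamma> j) - real m)"
        using m by (simp add: sumsq_spread[OF h m] of_nat_diff)
      have "jcoeff N \<theta> \<mu> ?l \<le> (if ?l \<in> rearr N \<mu> then 1 else \<theta>) * (1 + real (sumsq N \<mu>) - real (sumsq N ?l)) ^ ?p"
        by (rule less(2)[OF h m d])
      also have "\<dots> \<le> 1 * (1 + real (sumsq N \<mu>) - real (sumsq N ?l)) ^ ?p"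
        using le \<theta> by (intro mult_right_mono) auto
      finally show "0 \<le> 1 + ?A - 2 * (real (\<gamma> i) - real m) * (real (\<gamma> j) - real m) \<and>
        jcoeff N \<theta> \<mu> ?l \<le> (1 + ?A - 2 * (real (\<gamma> i) - real m) * (real (\<gamma> j) - real m)) ^ ?p"
        using le unfolding e[symmetric] by simp
    qed (use A in simp)
    have "lbsum N (jcoeff N \<theta> \<mu>) \<gamma> \<le> (\<Sum>i=1..N. \<Sum>j\<in>{1..N} - {i}. (1 + ?A) ^ Suc ?p / real (Suc ?p))"
      unfolding lbsum_def by (intro sum_mono inner)
    also have "\<dots> \<le> (\<Sum>i=1..N. real N * ((1 + ?A) ^ Suc ?p / real (Suc ?p)))"
    proof (rule sum_mono)
      fix i assume "i \<in> {1..N}"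
      have "real (card ({1..N} - {i})) \<le> real N" using card_Diff1_le[of "{1..N}" i] by simp
      then show "(\<Sum>j\<in>{1..N} - {i}. (1 + ?A) ^ Suc ?p / real (Suc ?p)) \<le> real N * ((1 + ?A) ^ Suc ?p / real (Suc ?p))"
        unfolding sum_constant using A by (intro mult_right_mono) auto
    qed
    also have "\<dots> = (real N)\<^sup>2 / real (Suc ?p) * (1 + ?A) ^ Suc ?p"
      by (simp add: power2_eq_square)
    \<comment> \<open>The exponent \<open>2 * N\<^sup>2\<close> is chosen for this step: at most
      \<open>N\<^sup>2\<close> pairs, each divided by \<open>Suc ?p\<close>, give at most
      \<open>1 / 2\<close>. Then \<open>(1 + ?A) / 2 \<le> ?A\<close>, as \<open>?A \<ge> 1\<close>,
      cancels against the denominator of the recursion.\<close>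
    also have "\<dots> \<le> 1 / 2 * (1 + ?A) ^ Suc ?p"
    proof (rule mult_right_mono)
      show "(real N)\<^sup>2 / real (Suc ?p) \<le> 1 / 2" by (simp add: pos_divide_le_eq del: of_nat_Suc) simp
    qed (use A in simp)
    also have "\<dots> = (1 + ?A) / 2 * (1 + ?A) ^ ?p" by simp
    also have "\<dots> \<le> ?A * (1 + ?A) ^ ?p" using A by (intro mult_right_mono) auto
    finally have L: "lbsum N (jcoeff N \<theta> \<mu>) \<gamma> \<le> ?A * (1 + ?A) ^ ?p" .
    have "?A * jcoeff N \<theta> \<mu> \<gamma> \<le> (lbeig N \<theta> \<mu> - lbeig N \<theta> \<gamma>) * jcoeff N \<theta> \<mu> \<gamma>"
      using lbeig_gap[OF \<mu> less(3,1) \<theta>(1)] jcoeff_nonneg[OF \<mu> \<theta>(1) less(1)] by (rule mult_right_mono)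
    also have "\<dots> = \<theta> * lbsum N (jcoeff N \<theta> \<mu>) \<gamma>" by (rule jcoeff_eigen[OF \<mu> \<theta>(1) less(1)])
    also have "\<dots> \<le> \<theta> * (?A * (1 + ?A) ^ ?p)" using L \<theta> by (intro mult_left_mono) auto
    finally have "?A * jcoeff N \<theta> \<mu> \<gamma> \<le> ?A * (\<theta> * (1 + ?A) ^ ?p)" by (simp add: mult_ac)
    then have "jcoeff N \<theta> \<mu> \<gamma> \<le> \<theta> * (1 + ?A) ^ ?p" using A by (subst (asm) mult_le_cancel_left_pos) auto
    then show ?thesis using False by (simp add: algebra_simps)
  qed
qed

lemma jcoeff_bound:
  assumes \<mu>: "\<mu> \<in> Par N" and \<theta>: "0 < \<theta>" "\<theta> \<le> 1" and \<gamma>: "\<gamma> \<in> Comp N (psize N \<mu>)"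
  shows "jcoeff N \<theta> \<mu> \<gamma> \<le> (if \<gamma> \<in> rearr N \<mu> then 1 else \<theta>) * (1 + real N * (real (psize N \<mu>))\<^sup>2) ^ (2 * N\<^sup>2)"
proof (cases "sub_dom N \<mu> \<gamma>")
  case True
  have "sumsq N \<mu> \<le> N * (psize N \<mu>)\<^sup>2"
    using sum_bounded_above[of "{1..N}" "\<lambda>i. (\<mu> i)\<^sup>2" "(psize N \<mu>)\<^sup>2"] Comp_le[OF Par_subset_Comp[OF \<mu>]]
    by (simp add: sumsq_def power_mono)
  then have "real (sumsq N \<mu>) \<le> real N * (real (psize N \<mu>))\<^sup>2"
    by (metis of_nat_le_iff of_nat_mult of_nat_power)
  moreover have "sumsq N \<gamma> \<le> sumsq N \<mu>" using sub_dom_sumsq_summax(2)[OF \<mu> True \<gamma>] .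
  ultimately show ?thesis
    using \<theta> by (intro order.trans[OF jcoeff_dom_bound[OF \<mu> \<theta> \<gamma> True]] mult_left_mono power_mono) auto
next
  case False
  then show ?thesis using jcoeff_not_dom[OF \<mu> False] \<theta> by simp
qed

section \<open>Size and limit of Jack polynomials\<close>

lemma card_Comp_le: "card (Comp N n) \<le> (n + 1) ^ N"
proof -
  have "inj_on (\<lambda>\<beta>. restrict \<beta> {1..N}) (Comp N n)"
  proof (rule inj_onI)
    fix \<beta> \<gamma> assume h: "\<beta> \<in> Comp N n" "\<gamma> \<in> Comp N n" "restrict \<beta> {1..N} = restrict \<gamma> {1..N}"
    show "\<beta> = \<gamma>"
    proof
      fix i show "\<beta> i = \<gamma> i"
      proof (cases "i \<in> {1..N}")
        case True
        then show ?thesis using h(3) by (metis restrict_apply')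
      qed (use h(1,2) in \<open>auto simp: Comp_def\<close>)
    qed
  qed
  moreover have "(\<lambda>\<beta>. restrict \<beta> {1..N}) ` Comp N n \<subseteq> {1..N} \<rightarrow>\<^sub>E {..n}"
    using Comp_le by auto
  ultimately have "card (Comp N n) \<le> card ({1..N} \<rightarrow>\<^sub>E {..n})"
    by (intro card_inj_on_le[of "\<lambda>\<beta>. restrict \<beta> {1..N}"]) (auto intro: finite_PiE)
  then show ?thesis by (simp add: card_PiE)
qed

lemma norm_mon_le:
  assumes "\<gamma> \<in> Comp N n" "\<And>i. i \<in> {1..N} \<Longrightarrow> norm (y i) \<le> R"
  shows "norm (mon N \<gamma> y) \<le> R ^ n"
proof -
  have "norm (mon N \<gamma> y) \<le> (\<Prod>i=1..N. R ^ \<gamma> i)"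
    unfolding mon_def prod_norm[symmetric] norm_power
    using assms by (intro prod_mono) (auto intro!: power_mono)
  also have "\<dots> = R ^ psize N \<gamma>" unfolding psize_def power_sum ..
  also have "psize N \<gamma> = n" using assms(1) by (simp add: Comp_def)
  finally show ?thesis .
qed

text \<open>A bound for the number of exponent vectors of degree \<open>n\<close> times the bound
  for their coefficients. Only its polynomial growth in \<open>n\<close> matters.\<close>

definition jpoly :: "nat \<Rightarrow> nat \<Rightarrow> real" where
  "jpoly N n = real ((n + 1) ^ N) * (1 + real N * (real n)\<^sup>2) ^ (2 * N\<^sup>2)"

lemma norm_jack_le:
  assumes \<mu>: "\<mu> \<in> Par N" and \<theta>: "0 < \<theta>" "\<theta> \<le> 1"
    and y: "\<And>i. i \<in> {1..N} \<Longrightarrow> norm (y i) \<le> R" and R: "R \<ge> 0"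
  shows "norm (jack N \<theta> \<mu> y) \<le> jpoly N (psize N \<mu>) * R ^ psize N \<mu>"
proof -
  let ?n = "psize N \<mu>"
  let ?q = "(1 + real N * (real ?n)\<^sup>2) ^ (2 * N\<^sup>2)"
  have "norm (jack N \<theta> \<mu> y) \<le> (\<Sum>\<gamma>\<in>Comp N ?n. ?q * R ^ ?n)"
    unfolding jack_eq[OF \<mu> \<theta>(1)]
  proof (rule sum_norm_le)
    fix \<gamma> assume \<gamma>: "\<gamma> \<in> Comp N ?n"
    have "jcoeff N \<theta> \<mu> \<gamma> \<le> (if \<gamma> \<in> rearr N \<mu> then 1 else \<theta>) * ?q"
      by (rule jcoeff_bound[OF \<mu> \<theta> \<gamma>])
    also have "\<dots> \<le> 1 * ?q" using \<theta> by (intro mult_right_mono) auto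
    finally show "norm (of_real (jcoeff N \<theta> \<mu> \<gamma>) * mon N \<gamma> y) \<le> ?q * R ^ ?n"
      unfolding norm_mult using jcoeff_nonneg[OF \<mu> \<theta>(1) \<gamma>] norm_mon_le[OF \<gamma> y]
      by (intro mult_mono) auto
  qed
  also have "\<dots> = real (card (Comp N ?n)) * (?q * R ^ ?n)" by simp
  also have "\<dots> \<le> real ((?n + 1) ^ N) * (?q * R ^ ?n)"
    using card_Comp_le[of N ?n] R by (intro mult_right_mono) (auto simp del: of_nat_power)
  finally show ?thesis by (simp add: jpoly_def mult.assoc)
qed

text \<open>At the all-ones point the value is the sum of the coefficients, which are nonnegative
  and include a \<open>1\<close>.\<close>

lemma norm_jack_one_ge:
  assumes \<mu>: "\<mu> \<in> Par N" and \<theta>: "0 < \<theta>"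
  shows "norm (jack N \<theta> \<mu> (\<lambda>i. 1)) \<ge> 1"
proof -
  let ?n = "psize N \<mu>"
  have "1 = jcoeff N \<theta> \<mu> \<mu>" by (simp add: jcoeff_rearr)
  also have "\<dots> \<le> (\<Sum>\<gamma>\<in>Comp N ?n. jcoeff N \<theta> \<mu> \<gamma>)"
    using Par_subset_Comp[OF \<mu>] jcoeff_nonneg[OF \<mu> \<theta>] by (intro member_le_sum) auto
  also have "\<dots> = norm (jack N \<theta> \<mu> (\<lambda>i. 1))"
  proof -
    have "jack N \<theta> \<mu> (\<lambda>i. 1) = of_real (\<Sum>\<gamma>\<in>Comp N ?n. jcoeff N \<theta> \<mu> \<gamma>)"
      unfolding jack_eq[OF \<mu> \<theta>] by (simp add: mon_def)
    then show ?thesis using jcoeff_nonneg[OF \<mu> \<theta>] by (simp add: sum_nonneg del: of_real_sum)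
  qed
  finally show ?thesis .
qed

lemma jack_tendsto_monom_sym:
  assumes \<mu>: "\<mu> \<in> Par N" and pos: "\<And>n. 0 < \<theta> n" and lim: "\<theta> \<longlonglongrightarrow> 0"
  shows "(\<lambda>n. jack N (\<theta> n) \<mu> y) \<longlonglongrightarrow> monom_sym N \<mu> y"
proof -
  let ?n = "psize N \<mu>"
  have r: "rearr N \<mu> \<subseteq> Comp N ?n" using rearr_Comp Par_subset_Comp[OF \<mu>] by blast
  have "monom_sym N \<mu> y = (\<Sum>\<gamma>\<in>Comp N ?n. of_real (if \<gamma> \<in> rearr N \<mu> then 1 else 0) * mon N \<gamma> y)"
    unfolding monom_sym_eq using r by (intro sum.mono_neutral_cong_left) auto
  moreover have "(\<lambda>n. jcoeff N (\<theta> n) \<mu> \<gamma>) \<longlonglongrightarrow> (if \<gamma> \<in> rearr N \<mu> then 1 else 0)"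
    if \<gamma>: "\<gamma> \<in> Comp N ?n" for \<gamma>
  proof (cases "\<gamma> \<in> rearr N \<mu>")
    case True
    then show ?thesis by (simp add: jcoeff_rearr)
  next
    case False
    let ?q = "(1 + real N * (real ?n)\<^sup>2) ^ (2 * N\<^sup>2)"
    have "eventually (\<lambda>n. \<theta> n \<le> 1) sequentially"
      using order_tendstoD(2)[OF lim, of 1] by (auto elim: eventually_mono)
    then have u: "eventually (\<lambda>n. jcoeff N (\<theta> n) \<mu> \<gamma> \<le> \<theta> n * ?q) sequentially"
      by eventually_elim (use jcoeff_bound[OF \<mu> pos _ \<gamma>] False in auto)
    have "(\<lambda>n. \<theta> n * ?q) \<longlonglongrightarrow> 0 * ?q" by (intro tendsto_intros lim)
    then have "(\<lambda>n. jcoeff N (\<theta> n) \<mu> \<gamma>) \<longlonglongrightarrow> 0"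
      using u jcoeff_nonneg[OF \<mu> pos \<gamma>]
      by (intro tendsto_sandwich[OF _ u tendsto_const]) auto
    then show ?thesis using False by simp
  qed
  ultimately show ?thesis
    unfolding jack_eq[OF \<mu> pos] by (auto intro!: tendsto_intros)
qed

lemma mon_scale: "\<gamma> \<in> Comp N n \<Longrightarrow> mon N \<gamma> (\<lambda>i. c * y i) = c ^ n * mon N \<gamma> y"
  unfolding mon_def power_mult_distrib prod.distrib power_sum[symmetric] psize_def[symmetric]
  by (simp add: Comp_def)

lemma jack_scale:
  assumes "\<mu> \<in> Par N" "0 < \<theta>"
  shows "jack N \<theta> \<mu> (\<lambda>i. c * y i) = c ^ psize N \<mu> * jack N \<theta> \<mu> y"
  unfolding jack_eq[OF assms] sum_distrib_left
proof (rule sum.cong)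
  fix \<gamma> assume \<gamma>: "\<gamma> \<in> Comp N (psize N \<mu>)"
  show "of_real (jcoeff N \<theta> \<mu> \<gamma>) * mon N \<gamma> (\<lambda>i. c * y i) =
      c ^ psize N \<mu> * (of_real (jcoeff N \<theta> \<mu> \<gamma>) * mon N \<gamma> y)"
    unfolding mon_scale[OF \<gamma>] by (rule mult.left_commute)
qed simp

section \<open>Hook products\<close>

lemma prod_arm_eq_fact: "(\<Prod>j=1..k. real k - real j + 1) = fact k"
proof -
  have "(\<Prod>j=1..k. real k - real j + 1) = (\<Prod>j=1..k. real j)"
    by (rule prod.reindex_bij_witness[of _ "\<lambda>j. Suc k - j" "\<lambda>j. Suc k - j"]) (auto simp: of_nat_diff)
  then show ?thesis by (simp add: fact_prod)
qed

text \<open>Leg lengths are nonnegative: rows \<open>1\<close> to \<open>i\<close> all reach column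
  \<open>j\<close>. Dropping them leaves the arm lengths plus one, whose product along a row is a
  factorial.\<close>

lemma hook_ge:
  assumes \<mu>: "\<mu> \<in> Par N" and \<theta>: "0 < \<theta>"
  shows "hook N \<theta> \<mu> \<ge> (\<Prod>i=1..N. fact (\<mu> i))"
proof -
  have "(\<Prod>i=1..N. \<Prod>j=1..\<mu> i. real (\<mu> i) - real j + 1) \<le> hook N \<theta> \<mu>"
    unfolding hook_def
  proof (intro prod_mono conjI prod_nonneg)
    fix i j assume i: "i \<in> {1..N}" and j: "j \<in> {1..\<mu> i}"
    \<comment> \<open>\<open>conj_part\<close> is a cardinality and would be \<open>0\<close> on an
      infinite set; \<open>j \<ge> 1\<close> excludes the zeros of \<open>\<mu>\<close> outside
      \<open>{1..N}\<close>.\<close>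
    have "finite {k. j \<le> \<mu> k}"
    proof (rule finite_subset)
      show "{k. j \<le> \<mu> k} \<subseteq> {1..N}"
      proof
        fix k assume "k \<in> {k. j \<le> \<mu> k}"
        then have "\<mu> k \<noteq> 0" using j by auto
        then show "k \<in> {1..N}" using \<mu> by (cases "k \<in> {1..N}") (simp_all add: Par_def)
      qed
    qed simp
    moreover have "{1..i} \<subseteq> {k. j \<le> \<mu> k}"
    proof
      fix k assume "k \<in> {1..i}"
      then have "\<mu> i \<le> \<mu> k" using \<mu> i by (auto simp: Par_def)
      then show "k \<in> {k. j \<le> \<mu> k}" using j by simp
    qed
    ultimately have "card {1..i} \<le> conj_part \<mu> j" unfolding conj_part_def by (intro card_mono)
    then show "real (\<mu> i) - real j + 1 \<le> real (\<mu> i) - real j + 1 + \<theta> * (real (conj_part \<mu> j) - real i)"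
      using \<theta> by simp
  qed auto
  then show ?thesis by (simp only: prod_arm_eq_fact)
qed

lemma hook_tendsto:
  assumes "\<theta> \<longlonglongrightarrow> 0"
  shows "(\<lambda>n. hook N (\<theta> n) \<mu>) \<longlonglongrightarrow> (\<Prod>i=1..N. fact (\<mu> i))"
proof -
  have "(\<lambda>n. hook N (\<theta> n) \<mu>) \<longlonglongrightarrow>
     (\<Prod>i=1..N. \<Prod>j=1..\<mu> i. real (\<mu> i) - real j + 1 + 0 * (real (conj_part \<mu> j) - real i))"
    unfolding hook_def by (intro tendsto_intros assms)
  then show ?thesis by (simp only: prod_arm_eq_fact mult_zero_left add_0_right)
qed

subsection \<open>The series\<close>

definition Comps :: "nat \<Rightarrow> (nat \<Rightarrow> nat) set" where
  "Comps N = {\<gamma>. \<forall>i. i \<notin> {1..N} \<longrightarrow> \<gamma> i = 0}"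

text \<open>Multiplication of absolutely convergent series, one coordinate at a time. Absolute
  summability is carried through the induction because iterated sums determine the sum over the
  product set only once summability is known there.\<close>

lemma has_sum_prod_Comps:
  fixes f :: "nat \<Rightarrow> nat \<Rightarrow> 'a :: {real_normed_field, banach}"
  assumes "\<And>i. i \<in> {1..N} \<Longrightarrow> (f i has_sum S i) UNIV"
    and "\<And>i. i \<in> {1..N} \<Longrightarrow> (\<lambda>k. norm (f i k)) summable_on UNIV"
  shows "((\<lambda>\<gamma>. \<Prod>i=1..N. f i (\<gamma> i)) has_sum (\<Prod>i=1..N. S i)) (Comps N) \<and>
    (\<lambda>\<gamma>. norm (\<Prod>i=1..N. f i (\<gamma> i))) summable_on Comps N"
  using assms
proof (induction N)
  case 0
  have "Comps 0 = {\<lambda>_. 0}" by (auto simp: Comps_def)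
  then show ?case by (simp add: has_sum_finite_iff)
next
  case (Suc N)
  let ?F = "\<lambda>\<gamma>. \<Prod>i=1..N. f i (\<gamma> i)"
  let ?G = "\<lambda>\<gamma>. \<Prod>i=1..Suc N. f i (\<gamma> i)"
  let ?h = "\<lambda>(\<gamma>, k). (\<gamma> :: nat \<Rightarrow> nat)(Suc N := k)"
  have IH: "(?F has_sum (\<Prod>i=1..N. S i)) (Comps N)" "(\<lambda>\<gamma>. norm (?F \<gamma>)) summable_on Comps N"
    using Suc by auto
  have bij: "bij_betw ?h (Comps N \<times> UNIV) (Comps (Suc N))"
    by (rule bij_betw_byWitness[where f' = "\<lambda>\<gamma>. (\<gamma>(Suc N := 0), \<gamma> (Suc N))"])
       (auto simp: Comps_def fun_eq_iff)
  have G: "?G (?h (\<gamma>, k)) = ?F \<gamma> * f (Suc N) k" for \<gamma> k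
  proof -
    have "(\<Prod>i=1..N. f i ((\<gamma>(Suc N := k)) i)) = ?F \<gamma>" by (intro prod.cong) auto
    then show ?thesis by simp
  qed
  have last: "(f (Suc N) has_sum S (Suc N)) UNIV" "(\<lambda>k. norm (f (Suc N) k)) summable_on UNIV"
    using Suc.prems by auto
  have sn: "(\<lambda>p. norm (?G (?h p))) summable_on (Comps N \<times> UNIV)"
  proof (rule summable_on_SigmaI)
    fix \<gamma> assume "\<gamma> \<in> Comps N"
    show "((\<lambda>k. norm (?G (?h (\<gamma>, k)))) has_sum norm (?F \<gamma>) * infsum (\<lambda>k. norm (f (Suc N) k)) UNIV) UNIV"
      unfolding G norm_mult by (intro has_sum_cmult_right has_sum_infsum last)
  next
    show "(\<lambda>\<gamma>. norm (?F \<gamma>) * infsum (\<lambda>k. norm (f (Suc N) k)) UNIV) summable_on Comps N"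
      by (intro summable_on_cmult_left IH)
  qed simp
  have "((\<lambda>p. ?G (?h p)) has_sum (\<Prod>i=1..N. S i) * S (Suc N)) (Comps N \<times> UNIV)"
  proof (rule has_sum_SigmaI)
    fix \<gamma> assume "\<gamma> \<in> Comps N"
    show "((\<lambda>k. ?G (?h (\<gamma>, k))) has_sum ?F \<gamma> * S (Suc N)) UNIV"
      unfolding G by (intro has_sum_cmult_right last)
  next
    show "((\<lambda>\<gamma>. ?F \<gamma> * S (Suc N)) has_sum (\<Prod>i=1..N. S i) * S (Suc N)) (Comps N)"
      by (intro has_sum_cmult_left IH)
  next
    show "(\<lambda>p. ?G (?h p)) summable_on (Comps N \<times> UNIV)"
      using sn by (rule abs_summable_summable)
  qed
  then have "(?G has_sum (\<Prod>i=1..Suc N. S i)) (Comps (Suc N))"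
    using has_sum_reindex_bij_betw[OF bij, of ?G] by simp
  moreover have "(\<lambda>\<gamma>. norm (?G \<gamma>)) summable_on Comps (Suc N)"
    using sn summable_on_reindex_bij_betw[OF bij, of "\<lambda>\<gamma>. norm (?G \<gamma>)"] by blast
  ultimately show ?case by blast
qed

lemma has_sum_exp:
  fixes z :: "'a :: {real_normed_field, banach}"
  shows "((\<lambda>k. z ^ k /\<^sub>R fact k) has_sum exp z) UNIV"
    and "(\<lambda>k. norm (z ^ k /\<^sub>R fact k)) summable_on UNIV"
  by (rule norm_summable_imp_has_sum[OF summable_norm_exp exp_converges])
     (rule summable_nonneg_imp_summable_on[OF summable_norm_exp norm_ge_zero])

text \<open>Tannery's theorem. By the Weierstrass M-test the finite partial sums converge uniformly
  over those \<open>n\<close> at which the majorant applies, so the two limits may be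
  swapped.\<close>

lemma tendsto_infsum_dominated:
  fixes f :: "nat \<Rightarrow> 'a \<Rightarrow> 'b :: banach"
  assumes lim: "\<And>x. x \<in> A \<Longrightarrow> (\<lambda>n. f n x) \<longlonglongrightarrow> g x"
    and bound: "eventually (\<lambda>n. \<forall>x\<in>A. norm (f n x) \<le> h x) sequentially"
    and h: "h summable_on A"
  shows "(\<lambda>n. infsum (f n) A) \<longlonglongrightarrow> infsum g A"
proof (rule swap_uniform_limit')
  let ?Y = "{n. \<forall>x\<in>A. norm (f n x) \<le> h x}"
  show "\<forall>\<^sub>F X in finite_subsets_at_top A. (\<lambda>n. \<Sum>x\<in>X. f n x) \<longlonglongrightarrow> (\<Sum>x\<in>X. g x)"
    using lim by (intro eventually_finite_subsets_at_top_weakI tendsto_sum) auto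
  show "uniform_limit ?Y (\<lambda>X n. \<Sum>x\<in>X. f n x) (\<lambda>n. infsum (f n) A) (finite_subsets_at_top A)"
    by (rule Weierstrass_m_test_general[where f = "\<lambda>x n. f n x", OF _ h]) auto
  show "\<forall>\<^sub>F n in sequentially. n \<in> ?Y" using bound by simp
  have "norm (g x) \<le> h x" if "x \<in> A" for x
  proof (rule tendsto_upperbound[OF tendsto_norm[OF lim[OF that]]])
    show "\<forall>\<^sub>F n in sequentially. norm (f n x) \<le> h x"
      using bound by eventually_elim (use that in auto)
  qed simp
  then have "g summable_on A"
    using h by (intro abs_summable_summable[OF summable_on_comparison_test[OF h]]) auto
  then show "((\<lambda>X. \<Sum>x\<in>X. g x) \<longlongrightarrow> infsum g A) (finite_subsets_at_top A)"
    using has_sum_infsum has_sum_def by blast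
qed simp

text \<open>Orbit and stabilizer: each rearrangement is hit by as many permutations as fix
  \<open>\<gamma>\<close>. The case of constant \<open>h\<close> shows that this number times the
  orbit size is \<open>fact N\<close>.\<close>

lemma sum_permutations_orbit:
  fixes h :: "(nat \<Rightarrow> nat) \<Rightarrow> complex"
  shows "(\<Sum>\<sigma> | \<sigma> permutes {1..N}. h (\<gamma> \<circ> \<sigma>)) * of_nat (card (rearr N \<gamma>)) =
    fact N * (\<Sum>\<beta>\<in>rearr N \<gamma>. h \<beta>)"
proof -
  let ?P = "{\<sigma>. \<sigma> permutes {1..N}}"
  let ?c = "card {\<sigma> \<in> ?P. \<gamma> \<circ> \<sigma> = \<gamma>}"
  have im: "(\<lambda>\<sigma>. \<gamma> \<circ> \<sigma>) ` ?P = rearr N \<gamma>" by (auto simp: rearr_def)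
  have c: "card {\<sigma> \<in> ?P. \<gamma> \<circ> \<sigma> = \<beta>} = ?c" if "\<beta> \<in> rearr N \<gamma>" for \<beta>
  proof -
    obtain \<tau> where \<tau>: "\<tau> permutes {1..N}" "\<beta> = \<gamma> \<circ> \<tau>" using \<open>\<beta> \<in> rearr N \<gamma>\<close> by (auto simp: rearr_def)
    have "bij_betw (\<lambda>\<sigma>. \<sigma> \<circ> \<tau>) {\<sigma> \<in> ?P. \<gamma> \<circ> \<sigma> = \<gamma>} {\<sigma> \<in> ?P. \<gamma> \<circ> \<sigma> = \<beta>}"
    proof (rule bij_betw_byWitness[where f' = "\<lambda>\<sigma>. \<sigma> \<circ> inv \<tau>"])
      show "(\<lambda>\<sigma>. \<sigma> \<circ> \<tau>) ` {\<sigma> \<in> ?P. \<gamma> \<circ> \<sigma> = \<gamma>} \<subseteq> {\<sigma> \<in> ?P. \<gamma> \<circ> \<sigma> = \<beta>}"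
        using \<tau> permutes_compose[OF \<tau>(1)] by (auto simp: o_assoc)
      show "(\<lambda>\<sigma>. \<sigma> \<circ> inv \<tau>) ` {\<sigma> \<in> ?P. \<gamma> \<circ> \<sigma> = \<beta>} \<subseteq> {\<sigma> \<in> ?P. \<gamma> \<circ> \<sigma> = \<gamma>}"
      proof
        fix \<rho> assume "\<rho> \<in> (\<lambda>\<sigma>. \<sigma> \<circ> inv \<tau>) ` {\<sigma> \<in> ?P. \<gamma> \<circ> \<sigma> = \<beta>}"
        then obtain \<sigma> where \<sigma>: "\<rho> = \<sigma> \<circ> inv \<tau>" "\<sigma> permutes {1..N}" "\<gamma> \<circ> \<sigma> = \<gamma> \<circ> \<tau>"
          using \<tau>(2) by auto
        have "\<gamma> \<circ> \<rho> = \<gamma>"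
          unfolding \<sigma>(1) o_assoc \<sigma>(3) unfolding o_assoc[symmetric] permutes_inv_o[OF \<tau>(1)] by simp
        then show "\<rho> \<in> {\<sigma> \<in> ?P. \<gamma> \<circ> \<sigma> = \<gamma>}"
          using permutes_compose[OF permutes_inv[OF \<tau>(1)] \<sigma>(2)] \<sigma>(1) by simp
      qed
    qed (simp_all add: o_assoc[symmetric] permutes_inv_o[OF \<tau>(1)])
    then show ?thesis by (simp add: bij_betw_same_card)
  qed
  have gen: "(\<Sum>\<sigma>\<in>?P. h (\<gamma> \<circ> \<sigma>)) = of_nat ?c * (\<Sum>\<beta>\<in>rearr N \<gamma>. h \<beta>)" for h :: "(nat \<Rightarrow> nat) \<Rightarrow> complex"
  proof -
    have "(\<Sum>\<sigma>\<in>?P. h (\<gamma> \<circ> \<sigma>)) = (\<Sum>\<beta>\<in>rearr N \<gamma>. \<Sum>\<sigma>\<in>{\<sigma> \<in> ?P. \<gamma> \<circ> \<sigma> = \<beta>}. h (\<gamma> \<circ> \<sigma>))"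
      unfolding im[symmetric] by (rule sum.image_gen) (simp add: finite_permutations)
    also have "\<dots> = (\<Sum>\<beta>\<in>rearr N \<gamma>. of_nat ?c * h \<beta>)"
    proof (rule sum.cong)
      fix \<beta> assume "\<beta> \<in> rearr N \<gamma>"
      have "(\<Sum>\<sigma>\<in>{\<sigma> \<in> ?P. \<gamma> \<circ> \<sigma> = \<beta>}. h (\<gamma> \<circ> \<sigma>)) = (\<Sum>\<sigma>\<in>{\<sigma> \<in> ?P. \<gamma> \<circ> \<sigma> = \<beta>}. h \<beta>)"
        by (intro sum.cong) auto
      then show "(\<Sum>\<sigma>\<in>{\<sigma> \<in> ?P. \<gamma> \<circ> \<sigma> = \<beta>}. h (\<gamma> \<circ> \<sigma>)) = of_nat ?c * h \<beta>"
        using c[OF \<open>\<beta> \<in> rearr N \<gamma>\<close>] by simp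
    qed simp
    finally show ?thesis by (simp add: sum_distrib_left)
  qed
  have "(fact N :: complex) = of_nat ?c * of_nat (card (rearr N \<gamma>))"
    using gen[of "\<lambda>_. 1"] by (simp add: card_permutations)
  then show ?thesis unfolding gen by (simp add: mult_ac)
qed

lemma mon_permutes:
  assumes \<sigma>: "\<sigma> permutes {1..N}"
  shows "mon N \<gamma> (\<lambda>i. \<xi> (\<sigma> i)) = mon N (\<gamma> \<circ> inv \<sigma>) \<xi>"
proof -
  have "mon N (\<gamma> \<circ> inv \<sigma>) \<xi> = (\<Prod>i=1..N. \<xi> (\<sigma> i) ^ (\<gamma> \<circ> inv \<sigma>) (\<sigma> i))"
    unfolding mon_def using prod.permute[OF \<sigma>, of "\<lambda>i. \<xi> i ^ (\<gamma> \<circ> inv \<sigma>) i"] by (simp add: o_def)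
  then show ?thesis by (simp add: mon_def permutes_inverses[OF \<sigma>])
qed

text \<open>The value of \<open>monom_sym\<close> at the all-ones point is the orbit size, so both
  sides are \<open>fact N\<close> times the mean of the monomials in the orbit.\<close>

lemma sum_mon_permutations:
  assumes \<gamma>: "\<gamma> \<in> rearr N \<mu>"
  shows "(\<Sum>\<sigma> | \<sigma> permutes {1..N}. mon N \<gamma> (\<lambda>i. \<xi> (\<sigma> i))) =
    fact N * (monom_sym N \<mu> \<xi> / monom_sym N \<mu> (\<lambda>i. 1))"
proof -
  have r: "rearr N \<gamma> = rearr N \<mu>" using \<gamma> rearr_trans rearr_sym by blast
  have one: "monom_sym N \<mu> (\<lambda>i. 1) = of_nat (card (rearr N \<mu>))"
    by (simp add: monom_sym_eq mon_def)
  have nz: "card (rearr N \<mu>) \<noteq> 0" using rearr_refl[of \<mu> N] by (metis card_eq_0_iff empty_iff finite_rearr)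
  have "(\<Sum>\<sigma> | \<sigma> permutes {1..N}. mon N \<gamma> (\<lambda>i. \<xi> (\<sigma> i))) =
      (\<Sum>\<sigma> | \<sigma> permutes {1..N}. mon N (\<gamma> \<circ> inv \<sigma>) \<xi>)"
    by (intro sum.cong refl mon_permutes) simp
  also have "\<dots> = (\<Sum>\<sigma> | \<sigma> permutes {1..N}. mon N (\<gamma> \<circ> \<sigma>) \<xi>)"
    by (rule sum_permutations_inverse[symmetric])
  finally show ?thesis
    using sum_permutations_orbit[of "\<lambda>\<beta>. mon N \<beta> \<xi>" \<gamma> N] nz
    unfolding r one monom_sym_eq[of N \<mu> \<xi>] by (simp add: field_simps)
qed

text \<open>Each product of exponentials is expanded over all exponent vectors, which are then
  grouped by their sorted form. Factorials are constant on an orbit, and averaging over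
  \<open>\<sigma>\<close> turns the monomial in \<open>\<xi>\<close> into a ratio of symmetric
  functions, leaving a sum over the orbit of monomials in \<open>\<alpha>\<close>.\<close>

lemma has_sum_symmetrized_exp:
  fixes \<alpha> \<xi> :: "nat \<Rightarrow> complex"
  shows "((\<lambda>\<mu>. 1 / of_real (\<Prod>i=1..N. fact (\<mu> i)) *
      (monom_sym N \<mu> \<alpha> * monom_sym N \<mu> \<xi> / monom_sym N \<mu> (\<lambda>i. 1))) has_sum
    (1 / fact N * (\<Sum>\<sigma> | \<sigma> permutes {1..N}. \<Prod>i=1..N. exp (\<alpha> i * \<xi> (\<sigma> i))))) (Par N)"
proof -
  let ?P = "{\<sigma>. \<sigma> permutes {1..N}}"
  define T where "T \<gamma> = 1 / fact N * (\<Sum>\<sigma>\<in>?P. \<Prod>i=1..N. (\<alpha> i * \<xi> (\<sigma> i)) ^ \<gamma> i /\<^sub>R fact (\<gamma> i))" for \<gamma>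
  have sum: "((\<lambda>\<gamma>. \<Sum>\<sigma>\<in>Q. \<Prod>i=1..N. (\<alpha> i * \<xi> (\<sigma> i)) ^ \<gamma> i /\<^sub>R fact (\<gamma> i)) has_sum
     (\<Sum>\<sigma>\<in>Q. \<Prod>i=1..N. exp (\<alpha> i * \<xi> (\<sigma> i)))) (Comps N)" if "finite Q" for Q :: "(nat \<Rightarrow> nat) set"
    using that
  proof (induction Q)
    case (insert \<sigma> Q)
    have "((\<lambda>\<gamma>. \<Prod>i=1..N. (\<alpha> i * \<xi> (\<sigma> i)) ^ \<gamma> i /\<^sub>R fact (\<gamma> i)) has_sum
        (\<Prod>i=1..N. exp (\<alpha> i * \<xi> (\<sigma> i)))) (Comps N)"
      using has_sum_prod_Comps[of N "\<lambda>i k. (\<alpha> i * \<xi> (\<sigma> i)) ^ k /\<^sub>R fact k" "\<lambda>i. exp (\<alpha> i * \<xi> (\<sigma> i))"]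
        has_sum_exp by blast
    from has_sum_add[OF this insert.IH] show ?case using insert.hyps by (simp add: sum.insert)
  qed simp
  have T: "(T has_sum (1 / fact N * (\<Sum>\<sigma>\<in>?P. \<Prod>i=1..N. exp (\<alpha> i * \<xi> (\<sigma> i))))) (Comps N)"
    unfolding T_def by (intro has_sum_cmult_right sum finite_permutations) simp
  have disj: "\<mu> = \<mu>'" if "\<mu> \<in> Par N" "\<mu>' \<in> Par N" "\<gamma> \<in> rearr N \<mu>" "\<gamma> \<in> rearr N \<mu>'" for \<mu> \<mu>' \<gamma>
    using that rearr_Par_unique rearr_sym rearr_trans by metis
  have "bij_betw snd (Sigma (Par N) (rearr N)) (Comps N)"
    unfolding bij_betw_def
  proof
    show "inj_on snd (Sigma (Par N) (rearr N))" using disj by (auto simp: inj_on_def)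
    show "snd ` Sigma (Par N) (rearr N) = Comps N"
    proof (intro equalityI subsetI)
      fix \<gamma> assume "\<gamma> \<in> Comps N"
      then have "\<gamma> \<in> Comp N (psize N \<gamma>)" by (auto simp: Comps_def Comp_def)
      then obtain \<mu> where "\<mu> \<in> Par N" "\<gamma> \<in> rearr N \<mu>" by (rule ex_Par_rearr)
      then have "(\<mu>, \<gamma>) \<in> Sigma (Par N) (rearr N)" by simp
      then show "\<gamma> \<in> snd ` Sigma (Par N) (rearr N)" by (rule image_eqI[rotated]) simp
    next
      fix \<gamma> assume "\<gamma> \<in> snd ` Sigma (Par N) (rearr N)"
      then obtain p where p: "p \<in> Sigma (Par N) (rearr N)" "\<gamma> = snd p" by (elim imageE)
      define \<mu> where "\<mu> = fst p"
      have \<mu>: "\<mu> \<in> Par N" "\<gamma> \<in> rearr N \<mu>"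
        unfolding \<mu>_def p(2) using p(1) by (metis mem_Sigma_iff prod.collapse)+
      have "\<gamma> \<in> Comp N (psize N \<mu>)"
        by (rule rearr_Comp[OF \<mu>(2) Par_subset_Comp[OF \<mu>(1)]])
      then show "\<gamma> \<in> Comps N" by (simp add: Comp_def Comps_def)
    qed
  qed
  from iffD2[OF has_sum_reindex_bij_betw[OF this] T]
  have "((\<lambda>p. T (snd p)) has_sum (1 / fact N * (\<Sum>\<sigma>\<in>?P. \<Prod>i=1..N. exp (\<alpha> i * \<xi> (\<sigma> i)))))
    (Sigma (Par N) (rearr N))" .
  then show ?thesis
  proof (rule has_sum_Sigma')
    fix \<mu> assume "\<mu> \<in> Par N"
    have t: "T \<gamma> = 1 / of_real (\<Prod>i=1..N. fact (\<mu> i)) *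
        (mon N \<gamma> \<alpha> * (monom_sym N \<mu> \<xi> / monom_sym N \<mu> (\<lambda>i. 1)))" if \<gamma>: "\<gamma> \<in> rearr N \<mu>" for \<gamma>
    proof -
      obtain \<tau> where \<tau>: "\<tau> permutes {1..N}" "\<gamma> = \<mu> \<circ> \<tau>" using \<gamma> by (auto simp: rearr_def)
      have f: "(\<Prod>i=1..N. fact (\<gamma> i) :: real) = (\<Prod>i=1..N. fact (\<mu> i))"
        unfolding \<tau>(2) using prod.permute[OF \<tau>(1), of "\<lambda>i. fact (\<mu> i) :: real"] by (simp add: o_def)
      have "(\<Prod>i=1..N. (\<alpha> i * \<xi> (\<sigma> i)) ^ \<gamma> i /\<^sub>R fact (\<gamma> i)) =
          1 / of_real (\<Prod>i=1..N. fact (\<gamma> i)) * (mon N \<gamma> \<alpha> * mon N \<gamma> (\<lambda>i. \<xi> (\<sigma> i)))" for \<sigma>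
      proof -
        have "(\<Prod>i=1..N. (\<alpha> i * \<xi> (\<sigma> i)) ^ \<gamma> i /\<^sub>R fact (\<gamma> i)) =
            (\<Prod>i=1..N. 1 / of_real (fact (\<gamma> i)) * (\<alpha> i ^ \<gamma> i * \<xi> (\<sigma> i) ^ \<gamma> i))"
          by (intro prod.cong refl) (simp add: scaleR_conv_of_real power_mult_distrib divide_inverse)
        also have "\<dots> = (\<Prod>i=1..N. 1 / of_real (fact (\<gamma> i))) * (mon N \<gamma> \<alpha> * mon N \<gamma> (\<lambda>i. \<xi> (\<sigma> i)))"
          by (simp only: prod.distrib mon_def)
        also have "(\<Prod>i=1..N. 1 / complex_of_real (fact (\<gamma> i))) = 1 / of_real (\<Prod>i=1..N. fact (\<gamma> i))"
          by (simp only: prod_dividef of_real_prod prod.neutral_const)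
        finally show ?thesis .
      qed
      then have "T \<gamma> = 1 / fact N * (\<Sum>\<sigma>\<in>?P. 1 / of_real (\<Prod>i=1..N. fact (\<gamma> i)) * (mon N \<gamma> \<alpha> * mon N \<gamma> (\<lambda>i. \<xi> (\<sigma> i))))"
        by (simp add: T_def)
      also have "\<dots> = 1 / fact N * (1 / of_real (\<Prod>i=1..N. fact (\<gamma> i)) * (mon N \<gamma> \<alpha> *
          (\<Sum>\<sigma>\<in>?P. mon N \<gamma> (\<lambda>i. \<xi> (\<sigma> i)))))"
        by (simp only: sum_distrib_left)
      finally show ?thesis unfolding sum_mon_permutations[OF \<gamma>] f by simp
    qed
    have "(\<Sum>\<gamma>\<in>rearr N \<mu>. T \<gamma>) = 1 / of_real (\<Prod>i=1..N. fact (\<mu> i)) *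
        (monom_sym N \<mu> \<alpha> * (monom_sym N \<mu> \<xi> / monom_sym N \<mu> (\<lambda>i. 1)))"
      unfolding monom_sym_eq[of N \<mu> \<alpha>] sum_distrib_right sum_distrib_left by (intro sum.cong refl t)
    then show "((\<lambda>\<gamma>. T (snd (\<mu>, \<gamma>))) has_sum 1 / of_real (\<Prod>i=1..N. fact (\<mu> i)) *
        (monom_sym N \<mu> \<alpha> * monom_sym N \<mu> \<xi> / monom_sym N \<mu> (\<lambda>i. 1))) (rearr N \<mu>)"
      by (simp add: has_sum_finite_iff)
  qed
qed

lemma power_le_fact_exp:
  assumes "x \<ge> 0" shows "x ^ k \<le> fact k * exp (x :: real)"
proof -
  have "(\<Sum>n\<in>{k}. x ^ n /\<^sub>R fact n) \<le> (\<Sum>n. x ^ n /\<^sub>R fact n)"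
    using assms by (intro sum_le_suminf summable_exp_generic) auto
  then show ?thesis by (simp add: exp_def field_simps)
qed

text \<open>The square appears because each summand has two Jack polynomials in its numerator. An
  exponential bound suffices, since it merely enlarges the argument of the majorizing exponential
  series.\<close>

lemma jpoly_square_le_exp: "\<exists>C\<ge>0. \<forall>n. (jpoly N n)\<^sup>2 \<le> C * exp 1 ^ n"
proof -
  \<comment> \<open>The degree in \<open>n + 1\<close> after squaring: \<open>N\<close> from the
    count of exponent vectors and \<open>2 * (2 * N\<^sup>2)\<close> from the coefficient
    bound.\<close>
  define k where "k = 2 * (N + 2 * (2 * N\<^sup>2))"
  define D where "D = ((1 + real N) ^ (2 * N\<^sup>2))\<^sup>2"
  have "(jpoly N n)\<^sup>2 \<le> (D * fact k * exp 1) * exp 1 ^ n" for n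
  proof -
    have "1 + real N * (real n)\<^sup>2 \<le> (1 + real N) * (real n + 1)\<^sup>2"
      by (simp add: power2_eq_square algebra_simps)
    then have "(1 + real N * (real n)\<^sup>2) ^ (2 * N\<^sup>2) \<le> ((1 + real N) * (real n + 1)\<^sup>2) ^ (2 * N\<^sup>2)"
      by (rule power_mono) simp
    also have "\<dots> = (1 + real N) ^ (2 * N\<^sup>2) * (real n + 1) ^ (2 * (2 * N\<^sup>2))"
      by (simp add: power_mult_distrib flip: power_mult)
    finally have "jpoly N n \<le> (real n + 1) ^ N * ((1 + real N) ^ (2 * N\<^sup>2) * (real n + 1) ^ (2 * (2 * N\<^sup>2)))"
      unfolding jpoly_def by (intro mult_mono) (auto simp: add.commute)
    also have "\<dots> = (1 + real N) ^ (2 * N\<^sup>2) * (real n + 1) ^ (N + 2 * (2 * N\<^sup>2))"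
      by (simp add: power_add)
    finally have "(jpoly N n)\<^sup>2 \<le> ((1 + real N) ^ (2 * N\<^sup>2) * (real n + 1) ^ (N + 2 * (2 * N\<^sup>2)))\<^sup>2"
      by (rule power_mono) (simp add: jpoly_def)
    also have "\<dots> = D * (real n + 1) ^ k"
      by (simp add: D_def k_def power_mult_distrib mult.commute flip: power_mult)
    also have "\<dots> \<le> D * (fact k * exp (real n + 1))"
      by (intro mult_left_mono power_le_fact_exp) (auto simp: D_def)
    also have "exp (real n + 1) = exp 1 ^ n * exp (1::real)"
      by (simp add: exp_add exp_of_nat_mult[symmetric])
    finally show ?thesis by (simp add: mult_ac)
  qed
  then show ?thesis by (intro exI[of _ "D * fact k * exp 1"]) (auto simp: D_def)
qed

section \<open>Gamma factors and summands of the Bessel series\<close>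

lemma Gamma_ratio:
  assumes "z > (0::real)"
  shows "Gamma z / Gamma (z + real k) = 1 / pochhammer z k"
proof -
  have "z \<notin> \<int>\<^sub>\<le>\<^sub>0" using assms by (auto elim!: nonpos_Ints_cases)
  then show ?thesis by (simp add: pochhammer_Gamma)
qed

lemma power_over_pochhammer:
  fixes s z :: real
  shows "s ^ k / pochhammer z k = (\<Prod>r<k. s / (z + real r))"
  by (simp add: pochhammer_prod prod_dividef atLeast0LessThan)

lemma power_over_pochhammer_le:
  fixes s z :: real
  assumes "s > 0" "z \<ge> s / 2"
  shows "0 \<le> s ^ k / pochhammer z k \<and> s ^ k / pochhammer z k \<le> 2 ^ k"
proof -
  have "(\<Prod>r<k. s / (z + real r)) \<le> (\<Prod>r<k. 2)"
    using assms by (intro prod_mono) (auto simp: divide_le_eq)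
  moreover have "(\<Prod>r<k. s / (z + real r)) \<ge> 0"
    using assms by (intro prod_nonneg) auto
  ultimately show ?thesis by (simp add: power_over_pochhammer)
qed

text \<open>The number \<open>k\<close> of factors is fixed, and each tends to \<open>1\<close>
  after division of numerator and denominator by \<open>s n\<close>.\<close>

lemma power_over_pochhammer_tendsto:
  fixes s \<theta> :: "nat \<Rightarrow> real"
  assumes s: "filterlim s at_top sequentially" and \<theta>: "\<theta> \<longlonglongrightarrow> 0"
  shows "(\<lambda>n. s n ^ k / pochhammer (s n - \<theta> n * c) k) \<longlonglongrightarrow> 1"
proof -
  have "(\<lambda>n. s n / (s n - \<theta> n * c + real r)) \<longlonglongrightarrow> 1" for r
  proof -
    have inf: "filterlim s at_infinity sequentially" using s by (rule filterlim_at_top_imp_at_infinity)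
    have "(\<lambda>n. \<theta> n * c / s n) \<longlonglongrightarrow> 0"
      by (rule tendsto_divide_0[OF tendsto_mult[OF \<theta> tendsto_const] inf])
    moreover have "(\<lambda>n. real r / s n) \<longlonglongrightarrow> 0"
      by (rule tendsto_divide_0[OF tendsto_const inf])
    ultimately have "(\<lambda>n. inverse (1 - \<theta> n * c / s n + real r / s n)) \<longlonglongrightarrow> inverse (1 - 0 + 0)"
      by (intro tendsto_intros) auto
    moreover have "eventually (\<lambda>n. inverse (1 - \<theta> n * c / s n + real r / s n) = s n / (s n - \<theta> n * c + real r)) sequentially"
      using filterlim_at_top_dense[THEN iffD1, OF s, rule_format, of 0]
    proof eventually_elim
      case (elim n)
      then have "1 - \<theta> n * c / s n + real r / s n = (s n - \<theta> n * c + real r) / s n"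
        by (simp add: field_simps)
      then show ?case by simp
    qed
    ultimately show ?thesis by (simp add: tendsto_cong)
  qed
  then have "(\<lambda>n. \<Prod>r<k. s n / (s n - \<theta> n * c + real r)) \<longlonglongrightarrow> (\<Prod>r<k. 1)"
    by (intro tendsto_prod)
  then show ?thesis by (simp add: power_over_pochhammer)
qed

text \<open>By homogeneity the scaling contributes
  \<open>(4 * M * \<theta>) ^ psize N \<mu>\<close>. The powers of \<open>4\<close> cancel the power
  of two in the series, and the rest is distributed over the rows to balance the Pochhammer
  symbols.\<close>

lemma bessel_summand:
  assumes \<mu>: "\<mu> \<in> Par N" and \<theta>: "0 < \<theta>" and M: "N \<le> M"
  shows "of_real ((\<Prod>i=1..N. Gamma (\<theta> * real M - \<theta> * (real i - 1)) /
                          Gamma (\<theta> * real M - \<theta> * (real i - 1) + real (\<mu> i))) *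
                 ((1 / 2 ^ (2 * psize N \<mu>)) / hook N \<theta> \<mu>)) *
        (jack N \<theta> \<mu> \<alpha> * jack N \<theta> \<mu> (\<lambda>i. (of_real (2 * sqrt (real M * \<theta>)) * x i)\<^sup>2) / jack N \<theta> \<mu> (\<lambda>i. 1)) =
    of_real ((\<Prod>i=1..N. (real M * \<theta>) ^ \<mu> i / pochhammer (real M * \<theta> - \<theta> * (real i - 1)) (\<mu> i)) / hook N \<theta> \<mu>) *
        (jack N \<theta> \<mu> \<alpha> * jack N \<theta> \<mu> (\<lambda>i. (x i)\<^sup>2) / jack N \<theta> \<mu> (\<lambda>i. 1))"
proof -
  define s where "s = real M * \<theta>"
  let ?n = "psize N \<mu>"
  have s: "s \<ge> 0" using \<theta> by (simp add: s_def)
  have "(\<lambda>i. (of_real (2 * sqrt s) * x i)\<^sup>2) = (\<lambda>i. of_real (4 * s) * (x i)\<^sup>2)"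
    using s by (simp add: power_mult_distrib flip: of_real_power)
  then have j: "jack N \<theta> \<mu> (\<lambda>i. (of_real (2 * sqrt s) * x i)\<^sup>2) =
      of_real ((4 * s) ^ ?n) * jack N \<theta> \<mu> (\<lambda>i. (x i)\<^sup>2)"
    by (simp only: jack_scale[OF \<mu> \<theta>] of_real_power)
  have "(\<Prod>i=1..N. Gamma (\<theta> * real M - \<theta> * (real i - 1)) /
        Gamma (\<theta> * real M - \<theta> * (real i - 1) + real (\<mu> i))) =
     (\<Prod>i=1..N. 1 / pochhammer (s - \<theta> * (real i - 1)) (\<mu> i))"
  proof (rule prod.cong)
    fix i assume i: "i \<in> {1..N}"
    have e: "\<theta> * real M - \<theta> * (real i - 1) = s - \<theta> * (real i - 1)" by (simp add: s_def)
    \<comment> \<open>\<open>N \<le> M\<close> keeps all Gamma arguments positive.\<close>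
    have "real i - 1 < real M" using i M by auto
    then have "s - \<theta> * (real i - 1) > 0" using \<theta> by (simp add: s_def mult.commute)
    then show "Gamma (\<theta> * real M - \<theta> * (real i - 1)) / Gamma (\<theta> * real M - \<theta> * (real i - 1) + real (\<mu> i)) =
        1 / pochhammer (s - \<theta> * (real i - 1)) (\<mu> i)"
      unfolding e by (rule Gamma_ratio)
  qed simp
  note gam = this
  have poch: "(\<Prod>i=1..N. s ^ \<mu> i / pochhammer (s - \<theta> * (real i - 1)) (\<mu> i)) =
     s ^ ?n * (\<Prod>i=1..N. 1 / pochhammer (s - \<theta> * (real i - 1)) (\<mu> i))"
    unfolding psize_def power_sum prod.distrib[symmetric] by simp
  have pow: "(4 * s) ^ ?n = 2 ^ (2 * ?n) * s ^ ?n"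
    by (simp add: power_mult power_mult_distrib)
  have gen: "of_real (P * ((1 / T) / H)) * (A * (of_real (T * S) * B) / J) = of_real (S * P / H) * (A * B / J)"
    if "T \<noteq> 0" for P T H S :: real and A B J :: complex
    using that by (cases "H = 0"; cases "J = 0") (simp_all add: field_simps)
  show ?thesis unfolding s_def[symmetric] j gam poch pow by (rule gen) simp
qed

text \<open>The Gamma factors cost \<open>2\<close> per box, since
  \<open>2 * (\<theta> * real N) \<le> s\<close> keeps each Pochhammer base above
  \<open>s / 2\<close>; the two Jack polynomials cost \<open>R * Q\<close> per box and
  \<open>C * exp 1 ^ psize N \<mu>\<close> in all. Hooks give the factorials, so the majorant
  factors over the rows into exponential series.\<close>

lemma norm_bessel_summand_le:
  assumes \<mu>: "\<mu> \<in> Par N" and \<theta>: "0 < \<theta>" "\<theta> \<le> 1" and s: "s > 0" "2 * (\<theta> * real N) \<le> s"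
    and y: "\<And>i. i \<in> {1..N} \<Longrightarrow> norm (\<alpha> i) \<le> R" "\<And>i. i \<in> {1..N} \<Longrightarrow> norm (\<xi> i) \<le> Q"
    and R: "R \<ge> 0" "Q \<ge> 0"
    and C: "\<And>n. (jpoly N n)\<^sup>2 \<le> C * exp 1 ^ n"
  shows "norm (of_real ((\<Prod>i=1..N. s ^ \<mu> i / pochhammer (s - \<theta> * (real i - 1)) (\<mu> i)) / hook N \<theta> \<mu>) *
      (jack N \<theta> \<mu> \<alpha> * jack N \<theta> \<mu> \<xi> / jack N \<theta> \<mu> (\<lambda>i. 1)))
    \<le> C * (\<Prod>i=1..N. (2 * exp 1 * R * Q) ^ \<mu> i /\<^sub>R fact (\<mu> i))"
proof -
  let ?n = "psize N \<mu>"
  let ?G = "\<Prod>i=1..N. s ^ \<mu> i / pochhammer (s - \<theta> * (real i - 1)) (\<mu> i)"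
  let ?F = "\<Prod>i=1..N. fact (\<mu> i) :: real"
  have F: "?F > 0" by (intro prod_pos) auto
  have g: "0 \<le> s ^ \<mu> i / pochhammer (s - \<theta> * (real i - 1)) (\<mu> i) \<and>
      s ^ \<mu> i / pochhammer (s - \<theta> * (real i - 1)) (\<mu> i) \<le> 2 ^ \<mu> i" if "i \<in> {1..N}" for i
  proof (rule power_over_pochhammer_le[OF s(1)])
    have "\<theta> * (real i - 1) \<le> \<theta> * real N" using that \<theta> by (intro mult_left_mono) auto
    then show "s / 2 \<le> s - \<theta> * (real i - 1)" using s(2) by linarith
  qed
  have "?G \<le> (\<Prod>i=1..N. 2 ^ \<mu> i)" using g by (intro prod_mono) auto
  also have "\<dots> = 2 ^ ?n" by (simp add: power_sum psize_def)
  finally have G: "?G \<le> 2 ^ ?n" .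
  have G0: "0 \<le> ?G" using g by (intro prod_nonneg) auto
  have h: "?F \<le> hook N \<theta> \<mu>" by (rule hook_ge[OF \<mu> \<theta>(1)])
  have "?G / hook N \<theta> \<mu> \<le> 2 ^ ?n / ?F" using G G0 h F by (intro frac_le) auto
  moreover have "0 \<le> ?G / hook N \<theta> \<mu>" using G0 h F by (intro divide_nonneg_nonneg) auto
  ultimately have 1: "norm (of_real (?G / hook N \<theta> \<mu>) :: complex) \<le> 2 ^ ?n / ?F"
    by (simp only: norm_of_real abs_of_nonneg)
  have jp: "jpoly N ?n \<ge> 0" by (simp add: jpoly_def)
  have one: "norm (jack N \<theta> \<mu> (\<lambda>i. 1)) \<ge> 1" by (rule norm_jack_one_ge[OF \<mu> \<theta>(1)])
  have num: "norm (jack N \<theta> \<mu> \<alpha> * jack N \<theta> \<mu> \<xi>) \<le> (jpoly N ?n * R ^ ?n) * (jpoly N ?n * Q ^ ?n)"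
    unfolding norm_mult using jp R
    by (intro mult_mono norm_jack_le[OF \<mu> \<theta>] y) auto
  have "norm (jack N \<theta> \<mu> \<alpha> * jack N \<theta> \<mu> \<xi> / jack N \<theta> \<mu> (\<lambda>i. 1)) \<le>
      norm (jack N \<theta> \<mu> \<alpha> * jack N \<theta> \<mu> \<xi>) / 1"
    unfolding norm_divide by (rule divide_left_mono[OF one]) (use one in auto)
  also have "\<dots> \<le> (jpoly N ?n)\<^sup>2 * (R * Q) ^ ?n"
    using num by (simp add: power2_eq_square power_mult_distrib mult_ac)
  also have "\<dots> \<le> (C * exp 1 ^ ?n) * (R * Q) ^ ?n"
    using R by (intro mult_right_mono C) auto
  finally have 2: "norm (jack N \<theta> \<mu> \<alpha> * jack N \<theta> \<mu> \<xi> / jack N \<theta> \<mu> (\<lambda>i. 1)) \<le> (C * exp 1 ^ ?n) * (R * Q) ^ ?n" .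
  have "norm (of_real (?G / hook N \<theta> \<mu>) * (jack N \<theta> \<mu> \<alpha> * jack N \<theta> \<mu> \<xi> / jack N \<theta> \<mu> (\<lambda>i. 1)))
      \<le> (2 ^ ?n / ?F) * ((C * exp 1 ^ ?n) * (R * Q) ^ ?n)"
    unfolding norm_mult[of "of_real (?G / hook N \<theta> \<mu>)"] using F by (intro mult_mono 1 2) auto
  also have "\<dots> = C * ((2 * exp 1 * R * Q) ^ ?n / ?F)"
    by (simp add: power_mult_distrib)
  also have "(2 * exp 1 * R * Q) ^ ?n / ?F = (\<Prod>i=1..N. (2 * exp 1 * R * Q) ^ \<mu> i / fact (\<mu> i))"
    unfolding psize_def power_sum prod_dividef ..
  also have "\<dots> = (\<Prod>i=1..N. (2 * exp 1 * R * Q) ^ \<mu> i /\<^sub>R fact (\<mu> i))"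
    by (simp add: divide_inverse mult.commute)
  finally show ?thesis .
qed

lemma ex_norm_bound: "\<exists>R\<ge>0. \<forall>i\<in>{1..N}. norm (y i :: complex) \<le> R" for N :: nat
  by (rule exI[of _ "\<Sum>i=1..N. norm (y i)"]) (auto intro!: sum_nonneg member_le_sum)

text \<open>The scale is \<open>2 * sqrt (M * \<theta>)\<close> because the arguments enter squared:
  the Gamma ratios behave like \<open>(M * \<theta>) ^ (- |\<mu>|)\<close> and the series carries
  \<open>4 ^ (- |\<mu>|)\<close>, so the squared scale must be \<open>4 * M * \<theta>\<close>.
  Scaling by \<open>M * \<theta>\<close> itself would leave a factor
  \<open>(M * \<theta> / 4) ^ |\<mu>|\<close>, which diverges for nonempty \<open>\<mu>\<close>. The
  joint limit is taken along arbitrary sequences of parameters, and \<open>x\<close> may be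
  complex.\<close>

theorem propositionA1:
  fixes N :: nat and a :: "nat \<Rightarrow> real" and x :: "nat \<Rightarrow> complex"
    and M :: "nat \<Rightarrow> nat" and \<theta> :: "nat \<Rightarrow> real"
  assumes a_decreasing: "\<And>i j. 1 \<le> i \<Longrightarrow> i \<le> j \<Longrightarrow> j \<le> N \<Longrightarrow> a j \<le> a i"
    and a_nonneg: "\<And>i. 1 \<le> i \<Longrightarrow> i \<le> N \<Longrightarrow> 0 \<le> a i"
    and M_ge: "\<And>n. N \<le> M n"
    and \<theta>_pos: "\<And>n. 0 < \<theta> n"
    and M_lim: "filterlim M at_top sequentially"
    and \<theta>_lim: "\<theta> \<longlonglongrightarrow> 0"
    and M\<theta>_lim: "filterlim (\<lambda>n. real (M n) * \<theta> n) at_top sequentially"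
  shows "(\<lambda>n. bessel_BC a (\<lambda>i. of_real (2 * sqrt (real (M n) * \<theta> n)) * x i) (\<theta> n) N (M n))
           \<longlonglongrightarrow> (1 / fact N) *
             (\<Sum>\<sigma> | \<sigma> permutes {1..N}. \<Prod>i=1..N. exp (of_real ((a i)\<^sup>2) * (x (\<sigma> i))\<^sup>2))"
proof -
  define \<alpha> where "\<alpha> i = complex_of_real ((a i)\<^sup>2)" for i
  define \<xi> where "\<xi> i = (x i)\<^sup>2" for i
  define s where "s n = real (M n) * \<theta> n" for n
  define t where "t n \<mu> = of_real ((\<Prod>i=1..N. s n ^ \<mu> i / pochhammer (s n - \<theta> n * (real i - 1)) (\<mu> i)) / hook N (\<theta> n) \<mu>) *
      (jack N (\<theta> n) \<mu> \<alpha> * jack N (\<theta> n) \<mu> \<xi> / jack N (\<theta> n) \<mu> (\<lambda>i. 1))" for n \<mu>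
  define g where "g \<mu> = 1 / of_real (\<Prod>i=1..N. fact (\<mu> i)) *
      (monom_sym N \<mu> \<alpha> * monom_sym N \<mu> \<xi> / monom_sym N \<mu> (\<lambda>i. 1))" for \<mu>
  obtain R Q where R: "R \<ge> 0" "\<And>i. i \<in> {1..N} \<Longrightarrow> norm (\<alpha> i) \<le> R"
    and Q: "Q \<ge> 0" "\<And>i. i \<in> {1..N} \<Longrightarrow> norm (\<xi> i) \<le> Q"
    using ex_norm_bound[of N \<alpha>] ex_norm_bound[of N \<xi>] by blast
  obtain C where C: "C \<ge> 0" "\<And>n. (jpoly N n)\<^sup>2 \<le> C * exp 1 ^ n"
    using jpoly_square_le_exp[of N] by blast
  let ?h = "\<lambda>\<mu>. C * (\<Prod>i=1..N. (2 * exp 1 * R * Q) ^ \<mu> i /\<^sub>R fact (\<mu> i))"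
  have s_lim: "filterlim s at_top sequentially" using M\<theta>_lim by (simp add: s_def[abs_def])
  have "(\<lambda>n. infsum (t n) (Par N)) \<longlonglongrightarrow> infsum g (Par N)"
  proof (rule tendsto_infsum_dominated)
    fix \<mu> assume \<mu>: "\<mu> \<in> Par N"
    have "monom_sym N \<mu> (\<lambda>i. 1) \<noteq> 0"
    proof -
      have "rearr N \<mu> \<noteq> {}" using rearr_refl by blast
      then show ?thesis by (simp add: monom_sym_eq mon_def)
    qed
    moreover have "(\<Prod>i=1..N. fact (\<mu> i) :: real) \<noteq> 0" by simp
    ultimately have "(\<lambda>n. t n \<mu>) \<longlonglongrightarrow> of_real ((\<Prod>i=1..N. 1) / (\<Prod>i=1..N. fact (\<mu> i))) *
        (monom_sym N \<mu> \<alpha> * monom_sym N \<mu> \<xi> / monom_sym N \<mu> (\<lambda>i. 1))"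
      unfolding t_def
      by (intro tendsto_mult tendsto_of_real tendsto_divide tendsto_prod jack_tendsto_monom_sym
          hook_tendsto power_over_pochhammer_tendsto \<mu> \<theta>_pos \<theta>_lim s_lim)
    then show "(\<lambda>n. t n \<mu>) \<longlonglongrightarrow> g \<mu>" by (simp add: g_def)
  next
    \<comment> \<open>Eventually \<open>2 * (\<theta> n * real N) < 1 < s n\<close>, which gives the
      size condition of \<open>norm_bessel_summand_le\<close>.\<close>
    have \<theta>N: "(\<lambda>n. 2 * (\<theta> n * real N)) \<longlonglongrightarrow> 2 * (0 * real N)" by (intro tendsto_intros \<theta>_lim)
    have "eventually (\<lambda>n. \<theta> n < 1) sequentially" using order_tendstoD(2)[OF \<theta>_lim] by simp
    moreover have "eventually (\<lambda>n. 2 * (\<theta> n * real N) < 1) sequentially"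
      using order_tendstoD(2)[OF \<theta>N] by simp
    moreover have "eventually (\<lambda>n. s n > 1) sequentially"
      using s_lim by (simp add: filterlim_at_top_dense)
    ultimately show "eventually (\<lambda>n. \<forall>\<mu>\<in>Par N. norm (t n \<mu>) \<le> ?h \<mu>) sequentially"
    proof eventually_elim
      case (elim n)
      show ?case unfolding t_def
        by (intro ballI norm_bessel_summand_le) (use elim \<theta>_pos R Q C in auto)
    qed
  next
    \<comment> \<open>The majorant is summed over all exponent vectors, where it factors, and then
      restricted to partitions.\<close>
    have "(\<lambda>\<mu>. norm (\<Prod>i=1..N. (2 * exp 1 * R * Q) ^ \<mu> i /\<^sub>R fact (\<mu> i))) summable_on Comps N"
      using has_sum_prod_Comps[of N "\<lambda>i k. (2 * exp 1 * R * Q) ^ k /\<^sub>R fact k" "\<lambda>i. exp (2 * exp 1 * R * Q)"]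
        has_sum_exp[of "2 * exp 1 * R * Q"] by blast
    then have "(\<lambda>\<mu>. \<Prod>i=1..N. (2 * exp 1 * R * Q) ^ \<mu> i /\<^sub>R fact (\<mu> i)) summable_on Comps N"
      by (rule abs_summable_summable)
    then have "?h summable_on Comps N" by (rule summable_on_cmult_right)
    then show "?h summable_on Par N"
      by (rule summable_on_subset_banach) (auto simp: Par_def Comps_def)
  qed
  moreover have "infsum g (Par N) = 1 / fact N *
      (\<Sum>\<sigma> | \<sigma> permutes {1..N}. \<Prod>i=1..N. exp (of_real ((a i)\<^sup>2) * (x (\<sigma> i))\<^sup>2))"
    using infsumI[OF has_sum_symmetrized_exp[of N \<alpha> \<xi>]] by (simp add: g_def[abs_def] \<alpha>_def \<xi>_def)
  moreover have "bessel_BC a (\<lambda>i. of_real (2 * sqrt (real (M n) * \<theta> n)) * x i) (\<theta> n) N (M n) =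
      infsum (t n) (Par N)" for n
    unfolding bessel_BC_def t_def s_def \<alpha>_def \<xi>_def
    by (intro infsum_cong bessel_summand \<theta>_pos M_ge)
  ultimately show ?thesis by simp
qed

end
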